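(* Let $m\ge1$ and suppose that $\sigma_kN+b_k>-1$, $\sigma_k\ge0$ and $\tau_k>0$ for $k=1,\dots,m$. For $z\ne0$ let $\zeta_m(z)$ be the largest real root of the algebraic equation in $x$ $$|z|^2\prod_{k=1}^m\big(\sigma_k-\sigma_m+\tau_k+x|z|^2\big)-\prod_{k=1}^m\big(\sigma_k-\sigma_m+x|z|^2\big)=0 .$$ Then for every complex number $z$ with $0<|z|<1$ the limiting eigenvalue density satisfies $$R_1(z):=\lim_{N\to\infty}\frac1NR_{N,1}(z)=\frac1{\pi|z|^2}\,\frac{1}{\sum_{k=1}^m\Big(\frac1{\sigma_k-\sigma_m+|z|^2\zeta_m(z)}-\frac1{\sigma_k-\sigma_m+\tau_k+|z|^2\zeta_m(z)}\Big)}\;\chi_{\{u:r_{\mathrm{in}}<|u|<r_{\mathrm{out}}\}}(z),$$ where $$r_{\mathrm{in}}=\sqrt{\frac{\sigma_1\cdots\sigma_m}{(\sigma_1+\tau_1)\cdots(\sigma_m+\tau_m)}},\qquad r_{\mathrm{out}}=\sqrt{\frac{(1+\sigma_1)\cdots(1+\sigma_m)}{(1+\sigma_1+\tau_1)\cdots(1+\sigma_m+\tau_m)}}.$$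
   Context: The parameters $\sigma_k,\tau_k,b_k$ are real and fixed. $R_{N,n}(z_1,\dots,z_n)=\det\big(K_N(z_j,z_k)\big)_{1\le j,k\le n}$ (for $|z_j|<1$) are the eigenvalue correlation functions for products of $m$ independent truncated unitary matrices, where $K_N(z,z')=\sqrt{w_m(z)w_m(\overline{z'})}\,T_N(z,z')$, $$T_N(z,z')=\prod_{k=1}^m\frac{\Gamma(\sigma_kN+b_k+1)}{\Gamma((\sigma_k+\tau_k)N+b_k+2)}\sum_{l=0}^{N-1}\prod_{k=1}^m\frac{\Gamma((\sigma_k+\tau_k)N+b_k+l+2)}{\Gamma(\sigma_kN+b_k+l+1)}(z\overline{z'})^l,$$ $$w_m(z)=\frac{2^{m-1}|z|^{2\sigma_mN+2b_m}}{\pi}\prod_{k=1}^m\frac{\Gamma((\sigma_k+\tau_k)N+b_k+2)}{\Gamma(\sigma_kN+b_k+1)\Gamma(\tau_kN+1)}\int_{[0,1]^{m-1}}e^{-Np(r)}q(r)\,d^{m-1}r,$$ $$p(r)=-\sum_{k=1}^{m-1}\big(2(\sigma_k-\sigma_m)\ln r_k+\tau_k\ln(1-r_k^2)_+\big)-\tau_m\ln\Big(1-\frac{|z|^2}{\prod_{k=1}^{m-1}r_k^2}\Big)_+,\qquad q(r)=\prod_{k=1}^{m-1}r_k^{2(b_k-b_m)-1}.$$ Here $x_+=\max(x,0)$ and $\ln0=-\infty$ (so the integrand vanishes there); for $m=1$ the integral is read as $(1-|z|^2)_+^{\tau_1N}$. Convention for $\chi$: if $r_{\mathrm{in}}>0$,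 $\chi_{\{u:r_{\mathrm{in}}<|u|<r_{\mathrm{out}}\}}(z)$ equals $1$ if $r_{\mathrm{in}}<|z|<r_{\mathrm{out}}$, $1/2$ if $|z|=r_{\mathrm{in}}$ or $|z|=r_{\mathrm{out}}$, and $0$ otherwise. If $r_{\mathrm{in}}=0$ it equals $1$ for $|z|<r_{\mathrm{out}}$, $1/2$ for $|z|=r_{\mathrm{out}}$, and $0$ otherwise. *)

theory Defs
  imports "HOL-Analysis.Analysis" "Jordan_Normal_Form.Determinant"
begin

text \<open>
  The parameters are functions \<open>\<sigma> \<tau> b :: nat \<Rightarrow> real\<close>, of which only the values at the
  indices \<open>1, \<dots>, m\<close> matter.
\<close>

definition phase :: "nat \<Rightarrow> (nat \<Rightarrow> real) \<Rightarrow> (nat \<Rightarrow> real) \<Rightarrow> complex \<Rightarrow> (nat \<Rightarrow> real) \<Rightarrow> real" where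
  "phase m \<sigma> \<tau> z r =
     - (\<Sum>k\<in>{1..<m}. 2 * (\<sigma> k - \<sigma> m) * ln (r k) + \<tau> k * ln (max (1 - (r k)\<^sup>2) 0))
     - \<tau> m * ln (max (1 - (cmod z)\<^sup>2 / (\<Prod>k\<in>{1..<m}. (r k)\<^sup>2)) 0)"

definition amplitude :: "nat \<Rightarrow> (nat \<Rightarrow> real) \<Rightarrow> (nat \<Rightarrow> real) \<Rightarrow> real" where
  "amplitude m b r = (\<Prod>k\<in>{1..<m}. r k powr (2 * (b k - b m) - 1))"

text \<open>
  The library sets \<open>ln 0 = 0\<close>, so the convention \<open>ln 0 = -\<infinity>\<close> (the integrand
  \<open>exp (- N p(r)) q(r)\<close> vanishes wherever a logarithm in \<open>p\<close> has argument \<open>0\<close>) is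
  written out as a case distinction.
\<close>

definition weight_integrand ::
  "nat \<Rightarrow> (nat \<Rightarrow> real) \<Rightarrow> (nat \<Rightarrow> real) \<Rightarrow> (nat \<Rightarrow> real) \<Rightarrow> nat \<Rightarrow> complex \<Rightarrow> (nat \<Rightarrow> real) \<Rightarrow> real" where
  "weight_integrand m \<sigma> \<tau> b N z r =
     (if (\<forall>k\<in>{1..<m}. r k > 0 \<and> 1 - (r k)\<^sup>2 > 0)
          \<and> 1 - (cmod z)\<^sup>2 / (\<Prod>k\<in>{1..<m}. (r k)\<^sup>2) > 0
      then exp (- real N * phase m \<sigma> \<tau> z r) * amplitude m b r
      else 0)"

text \<open>
  For \<open>m = 1\<close> the index set \<open>{1..<m}\<close> is empty and its product measure is a point mass, so
  the integral is \<open>(1 - |z|\<^sup>2) powr (\<tau>\<^sub>1 N)\<close> for \<open>|z| < 1\<close> and \<open>0\<close> otherwise, as required.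
\<close>

definition weight ::
  "nat \<Rightarrow> (nat \<Rightarrow> real) \<Rightarrow> (nat \<Rightarrow> real) \<Rightarrow> (nat \<Rightarrow> real) \<Rightarrow> nat \<Rightarrow> complex \<Rightarrow> real" where
  "weight m \<sigma> \<tau> b N z =
     2 ^ (m - 1) * cmod z powr (2 * \<sigma> m * real N + 2 * b m) / pi
     * (\<Prod>k\<in>{1..m}. Gamma ((\<sigma> k + \<tau> k) * real N + b k + 2)
          / (Gamma (\<sigma> k * real N + b k + 1) * Gamma (\<tau> k * real N + 1)))
     * (LINT r : (\<Pi>\<^sub>E k\<in>{1..<m}. {0..1}) | (\<Pi>\<^sub>M k\<in>{1..<m}. lborel).
          weight_integrand m \<sigma> \<tau> b N z r)"

definition truncated_sum ::
  "nat \<Rightarrow> (nat \<Rightarrow> real) \<Rightarrow> (nat \<Rightarrow> real) \<Rightarrow> (nat \<Rightarrow> real) \<Rightarrow> nat \<Rightarrow> complex \<Rightarrow> complex \<Rightarrow> complex" where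
  "truncated_sum m \<sigma> \<tau> b N z z' =
     of_real (\<Prod>k\<in>{1..m}. Gamma (\<sigma> k * real N + b k + 1)
                / Gamma ((\<sigma> k + \<tau> k) * real N + b k + 2))
     * (\<Sum>l<N. of_real (\<Prod>k\<in>{1..m}. Gamma ((\<sigma> k + \<tau> k) * real N + b k + real l + 2)
                / Gamma (\<sigma> k * real N + b k + real l + 1)) * (z * cnj z') ^ l)"

definition kernel ::
  "nat \<Rightarrow> (nat \<Rightarrow> real) \<Rightarrow> (nat \<Rightarrow> real) \<Rightarrow> (nat \<Rightarrow> real) \<Rightarrow> nat \<Rightarrow> complex \<Rightarrow> complex \<Rightarrow> complex" where
  "kernel m \<sigma> \<tau> b N z z' =
     of_real (sqrt (weight m \<sigma> \<tau> b N z * weight m \<sigma> \<tau> b N (cnj z')))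
     * truncated_sum m \<sigma> \<tau> b N z z'"

text \<open>\<open>R\<^bsub>N,n\<^esub>(z\<^sub>1, \<dots>, z\<^sub>n)\<close>, where \<open>n\<close> is the length of the list of points.\<close>

definition correlation ::
  "nat \<Rightarrow> (nat \<Rightarrow> real) \<Rightarrow> (nat \<Rightarrow> real) \<Rightarrow> (nat \<Rightarrow> real) \<Rightarrow> nat \<Rightarrow> complex list \<Rightarrow> complex" where
  "correlation m \<sigma> \<tau> b N zs =
     Determinant.det (Matrix.mat (length zs) (length zs)
       (\<lambda>(j, k). kernel m \<sigma> \<tau> b N (zs ! j) (zs ! k)))"

text \<open>
  For \<open>0 < |z| < 1\<close> the equation is polynomial in \<open>x\<close> with leading coefficient
  \<open>|z|\<^bsup>2m\<^esup> (|z|\<^sup>2 - 1) \<noteq> 0\<close>.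
\<close>

definition zeta :: "nat \<Rightarrow> (nat \<Rightarrow> real) \<Rightarrow> (nat \<Rightarrow> real) \<Rightarrow> complex \<Rightarrow> real" where
  "zeta m \<sigma> \<tau> z = (GREATEST x::real.
     (cmod z)\<^sup>2 * (\<Prod>k\<in>{1..m}. \<sigma> k - \<sigma> m + \<tau> k + x * (cmod z)\<^sup>2)
       - (\<Prod>k\<in>{1..m}. \<sigma> k - \<sigma> m + x * (cmod z)\<^sup>2) = 0)"

definition r_in :: "nat \<Rightarrow> (nat \<Rightarrow> real) \<Rightarrow> (nat \<Rightarrow> real) \<Rightarrow> real" where
  "r_in m \<sigma> \<tau> = sqrt ((\<Prod>k\<in>{1..m}. \<sigma> k) / (\<Prod>k\<in>{1..m}. \<sigma> k + \<tau> k))"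

definition r_out :: "nat \<Rightarrow> (nat \<Rightarrow> real) \<Rightarrow> (nat \<Rightarrow> real) \<Rightarrow> real" where
  "r_out m \<sigma> \<tau> = sqrt ((\<Prod>k\<in>{1..m}. 1 + \<sigma> k) / (\<Prod>k\<in>{1..m}. 1 + \<sigma> k + \<tau> k))"

text \<open>
  On the boundary circles the value is \<open>1/2\<close>; if \<open>\<rho>\<^sub>1 = 0\<close> there is no inner circle and
  the origin belongs to the disc.
\<close>

definition annulus_chi :: "real \<Rightarrow> real \<Rightarrow> complex \<Rightarrow> real" where
  "annulus_chi \<rho>\<^sub>1 \<rho>\<^sub>2 z =
     (if \<rho>\<^sub>1 > 0 then
        (if \<rho>\<^sub>1 < cmod z \<and> cmod z < \<rho>\<^sub>2 then 1
         else if cmod z = \<rho>\<^sub>1 \<or> cmod z = \<rho>\<^sub>2 then 1 / 2 else 0)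
      else
        (if cmod z < \<rho>\<^sub>2 then 1 else if cmod z = \<rho>\<^sub>2 then 1 / 2 else 0))"

end

(*
  Write x = |z|^2. The function x |-> pi * w_m times x^l, suitably normalised, is the density of a
  product of m independent Beta variables, and R_{N,1} is 1/pi times the sum over l < N of these
  densities. Choose t with prod_k (sigma_k + t) / (sigma_k + tau_k + t) = x, so that |z|^2 zeta_m(z)
  equals sigma_m + t. Tilting the logarithms of the Beta variables by t N, recentring them at the
  saddle point and rescaling by sqrt N turns the integral in w_m into an m-fold convolution at 0 of
  explicit profiles, and the l-th coefficient of T_N into the reciprocal of the product of their
  moment generating functions at (l - t N) / sqrt N. All tilts cancel, so that no asymptotics of
  Gamma is needed: dominated convergence gives Gaussian limits with variances
  v_k = 1 / (sigma_k + t) - 1 / (sigma_k + tau_k + t). The convolution contributes a Gaussian density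
  of variance V = sum_k v_k at 0, the sum over l a Gaussian integral of variance 1 / V over the
  line, a half-line or the empty set, according to the position of t with respect to 0 and 1. All
  other factors cancel, which leaves chi / (pi x V).
*)
theory Submission
  imports Defs "HOL-Probability.Probability" "HOL-Real_Asymp.Real_Asymp"
begin

text \<open>One argument covers the inside, the boundary and the outside of the annulus, because t
  only has to exceed -min \<sigma>_k: it may be negative or above 1, and \<sigma>_k + t stays
  positive even if \<sigma>_k = 0. The cancellation of the tilts is exact at each N: in the weight
  the m centred logarithms are constrained to sum to 0, and x^l splits into the product of the
  \<rho>_k^l, where \<rho>_k = (\<sigma>_k + t) / (\<sigma>_k + \<tau>_k + t). The powers of N are
  exact too: m - 1 Jacobians give N^(-(m-1)/2), the passage to m generating functions gives N^(m/2),
  and the prefactor 1/N leaves N^(-1/2), the mesh of a Riemann sum in s = (l - t N) / sqrt N. The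
  obstacle is uniformity: s reaches size sqrt N, where a pointwise Gaussian limit does not control
  the terms. The remedy is a lower bound c exp |s| for the generating functions at every s where
  they converge; for all l >= 0 this convergence is what \<sigma>_k N + b_k > -1 provides.\<close>

section \<open>Dominated convergence under an eventual bound\<close>

text \<open>The profiles obey their exponential majorants only for large N, so the usual theorem is
  applied to the sequence shifted by \<open>n0\<close>. Eventual integrability is exported for the
  comparison of integrals in \<open>bump_mgf_lower_bound\<close>.\<close>

lemma dominated_convergence_eventually:
  fixes f :: "nat \<Rightarrow> 'a \<Rightarrow> real"
  assumes "\<And>n. f n \<in> borel_measurable M" and "g \<in> borel_measurable M" and "integrable M w"
    and lim: "\<And>x. x \<in> space M \<Longrightarrow> (\<lambda>n. f n x) \<longlonglongrightarrow> g x"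
    and bound: "\<forall>\<^sub>F n in sequentially. \<forall>x\<in>space M. \<bar>f n x\<bar> \<le> w x"
  shows "(\<lambda>n. integral\<^sup>L M (f n)) \<longlonglongrightarrow> integral\<^sup>L M g"
    and "\<forall>\<^sub>F n in sequentially. integrable M (f n)"
    and "integrable M g"
proof -
  obtain n0 where n0: "\<And>n x. n \<ge> n0 \<Longrightarrow> x \<in> space M \<Longrightarrow> \<bar>f n x\<bar> \<le> w x"
    using bound unfolding eventually_sequentially by blast
  have "(\<lambda>n. integral\<^sup>L M (f (n + n0))) \<longlonglongrightarrow> integral\<^sup>L M g"
    by (rule integral_dominated_convergence[where w = w])
      (auto intro!: assms AE_I2 n0 LIMSEQ_ignore_initial_segment)
  then show "(\<lambda>n. integral\<^sup>L M (f n)) \<longlonglongrightarrow> integral\<^sup>L M g"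
    by (rule LIMSEQ_offset)
  show "\<forall>\<^sub>F n in sequentially. integrable M (f n)"
    unfolding eventually_sequentially
  proof (intro exI[of _ n0] allI impI)
    fix n assume n: "n0 \<le> n"
    show "integrable M (f n)"
      by (rule Bochner_Integration.integrable_bound[OF assms(3) assms(1)])
        (use n0[OF n] in \<open>auto intro!: AE_I2 intro: order_trans[OF _ abs_ge_self]\<close>)
  qed
  show "integrable M g"
    by (rule integrable_dominated_convergence[where w = w and s = "\<lambda>n. f (n + n0)"])
      (auto intro!: assms AE_I2 n0 LIMSEQ_ignore_initial_segment)
qed

section \<open>The rescaled Beta profile\<close>

text \<open>
  Let \<open>U\<close> have the Beta density proportional to \<open>u powr (\<alpha> N + \<beta> - 1) * (1 - u) powr (\<tau> N)\<close>.
  With \<open>x = sqrt N\<close>, \<open>bump \<alpha> \<tau> \<beta> x w\<close> is the density of \<open>ln U\<close> at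
  \<open>ln (\<alpha> / (\<alpha> + \<tau>)) + w / x\<close>, divided by its value at \<open>w = 0\<close>.
\<close>

definition bump :: "real \<Rightarrow> real \<Rightarrow> real \<Rightarrow> real \<Rightarrow> real \<Rightarrow> real" where
  "bump \<alpha> \<tau> \<beta> x w =
     (if \<alpha> * exp (w / x) < \<alpha> + \<tau>
      then exp ((\<alpha> * x\<^sup>2 + \<beta>) * w / x) * ((\<alpha> + \<tau> - \<alpha> * exp (w / x)) / \<tau>) powr (\<tau> * x\<^sup>2)
      else 0)"

text \<open>This is the limit variance of sqrt N * ln U for the Beta variable U above, and, at
  \<alpha> = \<sigma> k + t, the k-th summand in the denominator of the limiting density.\<close>

definition bump_var :: "real \<Rightarrow> real \<Rightarrow> real" where
  "bump_var \<alpha> \<tau> = 1 / \<alpha> - 1 / (\<alpha> + \<tau>)"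

lemma bump_var_pos: "\<alpha> > 0 \<Longrightarrow> \<tau> > 0 \<Longrightarrow> bump_var \<alpha> \<tau> > 0"
  by (simp add: bump_var_def frac_less2)

lemma bump_nonneg: "bump \<alpha> \<tau> \<beta> x w \<ge> 0"
  by (simp add: bump_def)

lemma bump_measurable [measurable]: "bump \<alpha> \<tau> \<beta> x \<in> borel_measurable borel"
  unfolding bump_def by measurable

text \<open>Second order expansion of the logarithm in w / x. The terms \<alpha> x w and -\<alpha> x
  w cancel because the profile is centred at the maximum; the quadratic terms add up to -\<alpha>
  (\<alpha> + \<tau>) / (2 \<tau>) times the square of w, and the \<beta> term is of order 1 /
  x.\<close>

lemma bump_tendsto:
  assumes "\<alpha> > 0" "\<tau> > 0"
  shows "((\<lambda>x. bump \<alpha> \<tau> \<beta> x w) \<longlongrightarrow> exp (- w\<^sup>2 / (2 * bump_var \<alpha> \<tau>))) at_top"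
proof -
  define L where "L = (\<lambda>x. (\<alpha> * x\<^sup>2 + \<beta>) * w / x + \<tau> * x\<^sup>2 * ln (1 - \<alpha> / \<tau> * (exp (w / x) - 1)))"
  have lim: "((\<lambda>x. exp (w / x)) \<longlongrightarrow> 1) at_top"
    by real_asymp
  have "\<forall>\<^sub>F x in at_top. exp (w / x) < (\<alpha> + \<tau>) / \<alpha>"
    by (rule order_tendstoD(2)[OF lim]) (use assms in simp)
  moreover have "\<forall>\<^sub>F x::real in at_top. x > 0"
    by (rule eventually_gt_at_top)
  ultimately have ev: "\<forall>\<^sub>F x in at_top. exp (L x) = bump \<alpha> \<tau> \<beta> x w"
  proof eventually_elim
    case (elim x)
    then have "\<alpha> * exp (w / x) < \<alpha> + \<tau>"
      using assms by (simp add: field_simps)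
    moreover have "(\<alpha> + \<tau> - \<alpha> * exp (w / x)) / \<tau> = 1 - \<alpha> / \<tau> * (exp (w / x) - 1)"
      using assms by (simp add: field_simps)
    ultimately show ?case
      using assms by (auto simp: bump_def L_def exp_add powr_def field_simps)
  qed
  have "(L \<longlongrightarrow> - w\<^sup>2 / (2 * bump_var \<alpha> \<tau>)) at_top"
  proof -
    have eq: "bump_var \<alpha> \<tau> = \<tau> / (\<alpha> * (\<alpha> + \<tau>))"
      using assms by (simp add: bump_var_def field_simps)
    \<comment> \<open>Fixing the sign of \<open>w\<close> determines the signs of the leading
      coefficients in the expansions.\<close>
    consider "w = 0" | "w > 0" | "w < 0" by linarith
    then show ?thesis
    proof cases
      case 1
      then show ?thesis by (simp add: L_def)
    next
      case 2
      then show ?thesis unfolding L_def eq using assms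
        by (real_asymp simp: field_simps power2_eq_square)
    next
      case 3
      then show ?thesis unfolding L_def eq using assms
        by (real_asymp simp: field_simps power2_eq_square)
    qed
  qed
  then have "((\<lambda>x. exp (L x)) \<longlongrightarrow> exp (- w\<^sup>2 / (2 * bump_var \<alpha> \<tau>))) at_top"
    by (rule tendsto_exp)
  then show ?thesis
    using ev by (rule Lim_transform_eventually)
qed

text \<open>The bound is the tangent of \<open>exp\<close> at \<open>\<kappa> / x\<close>, after \<open>ln y \<le> y - 1\<close>.\<close>

lemma bump_le_tangent:
  assumes "\<alpha> > 0" "\<tau> > 0" "x > 0"
  shows "bump \<alpha> \<tau> \<beta> x w \<le>
    exp ((\<beta> / x - \<alpha> * x * (exp (\<kappa> / x) - 1)) * w + \<alpha> * x\<^sup>2 * (1 - exp (\<kappa> / x) * (1 - \<kappa> / x)))"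
proof (cases "\<alpha> * exp (w / x) < \<alpha> + \<tau>")
  case False
  then show ?thesis by (simp add: bump_def)
next
  case True
  define y where "y = (\<alpha> + \<tau> - \<alpha> * exp (w / x)) / \<tau>"
  have y: "y > 0" using True assms by (simp add: y_def)
  have "ln y \<le> y - 1" using y by (rule ln_le_minus_one)
  also have "y - 1 = - \<alpha> * (exp (w / x) - 1) / \<tau>"
    using assms by (simp add: y_def field_simps)
  finally have "\<tau> * x\<^sup>2 * ln y \<le> \<tau> * x\<^sup>2 * (- \<alpha> * (exp (w / x) - 1) / \<tau>)"
    using assms by (intro mult_left_mono) auto
  also have "\<dots> = - \<alpha> * x\<^sup>2 * (exp (w / x) - 1)"
    using assms by simp
  also have "\<dots> \<le> - \<alpha> * x\<^sup>2 * (exp (\<kappa> / x) * (1 + (w / x - \<kappa> / x)) - 1)"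
  proof -
    have "exp (\<kappa> / x) * (1 + (w / x - \<kappa> / x)) \<le> exp (\<kappa> / x) * exp (w / x - \<kappa> / x)"
      by (intro mult_left_mono exp_ge_add_one_self) auto
    also have "\<dots> = exp (w / x)"
      by (simp add: exp_add[symmetric])
    finally have "exp (\<kappa> / x) * (1 + (w / x - \<kappa> / x)) - 1 \<le> exp (w / x) - 1"
      by simp
    then show ?thesis
      using assms by (simp add: mult_left_mono)
  qed
  finally have "(\<alpha> * x\<^sup>2 + \<beta>) * w / x + \<tau> * x\<^sup>2 * ln y \<le>
      (\<alpha> * x\<^sup>2 + \<beta>) * w / x - \<alpha> * x\<^sup>2 * (exp (\<kappa> / x) * (1 + (w / x - \<kappa> / x)) - 1)"
    by simp
  also have "\<dots> = (\<beta> / x - \<alpha> * x * (exp (\<kappa> / x) - 1)) * w + \<alpha> * x\<^sup>2 * (1 - exp (\<kappa> / x) * (1 - \<kappa> / x))"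
    using assms by (simp add: field_simps power2_eq_square)
  finally show ?thesis
    using True y by (simp add: bump_def y_def[symmetric] powr_def exp_add[symmetric])
qed

text \<open>The tangent at \<kappa> serves w >= 0, the tangent at -\<kappa> serves w < 0. Their
  slopes tend to -\<alpha> \<kappa> and \<alpha> \<kappa> and their constants to \<alpha> \<kappa>^2
  / 2, so a large \<kappa> yields any rate K. An arbitrary rate is wanted so that the majorant can
  absorb a factor exp (s w).\<close>

lemma bump_bound:
  assumes "\<alpha> > 0" "\<tau> > 0" "K > 0"
  obtains C where "C > 0" "\<forall>\<^sub>F x in at_top. \<forall>w. bump \<alpha> \<tau> \<beta> x w \<le> C * exp (- K * \<bar>w\<bar>)"
proof -
  \<comment> \<open>The limiting slopes have absolute value K + 1; the surplus 1 leaves room for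
    finite x. The 1 in \<open>B\<close> below has the same purpose.\<close>
  define \<kappa> where "\<kappa> = (K + 1) / \<alpha>"
  have \<kappa>: "\<kappa> > 0" "\<alpha> * \<kappa> = K + 1" using assms by (auto simp: \<kappa>_def)
  have slope: "((\<lambda>x. \<beta> / x - \<alpha> * x * (exp (k / x) - 1)) \<longlongrightarrow> - \<alpha> * k) at_top" if "k \<noteq> 0" for k
    using that assms by (cases "k > 0") (real_asymp | simp)+
  have const: "((\<lambda>x. \<alpha> * x\<^sup>2 * (1 - exp (k / x) * (1 - k / x))) \<longlongrightarrow> \<alpha> * k\<^sup>2 / 2) at_top" if "k \<noteq> 0" for k
    using that assms by (cases "k > 0") (real_asymp simp: power2_eq_square | simp)+
  define B where "B = \<alpha> * \<kappa>\<^sup>2 / 2 + 1"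
  have "\<forall>\<^sub>F x in at_top. \<beta> / x - \<alpha> * x * (exp (\<kappa> / x) - 1) < - K"
    by (rule order_tendstoD(2)[OF slope]) (use \<kappa> in auto)
  moreover have "\<forall>\<^sub>F x in at_top. \<beta> / x - \<alpha> * x * (exp (- \<kappa> / x) - 1) > K"
    by (rule order_tendstoD(1)[OF slope]) (use \<kappa> in auto)
  moreover have "\<forall>\<^sub>F x in at_top. \<alpha> * x\<^sup>2 * (1 - exp (\<kappa> / x) * (1 - \<kappa> / x)) < B"
    by (rule order_tendstoD(2)[OF const]) (use \<kappa> in \<open>auto simp: B_def\<close>)
  moreover have "\<forall>\<^sub>F x in at_top. \<alpha> * x\<^sup>2 * (1 - exp (- \<kappa> / x) * (1 - (- \<kappa>) / x)) < B"
    by (rule order_tendstoD(2)[OF const]) (use \<kappa> in \<open>auto simp: B_def\<close>)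
  moreover have "\<forall>\<^sub>F x::real in at_top. x > 0"
    by (rule eventually_gt_at_top)
  ultimately have "\<forall>\<^sub>F x in at_top. \<forall>w. bump \<alpha> \<tau> \<beta> x w \<le> exp B * exp (- K * \<bar>w\<bar>)"
  proof eventually_elim
    case (elim x)
    show ?case
    proof
      fix w
      show "bump \<alpha> \<tau> \<beta> x w \<le> exp B * exp (- K * \<bar>w\<bar>)"
      proof (cases "w \<ge> 0")
        case True
        have "(\<beta> / x - \<alpha> * x * (exp (\<kappa> / x) - 1)) * w \<le> - K * w"
          using True elim(1) by (intro mult_right_mono) auto
        then show ?thesis
          using bump_le_tangent[OF assms(1,2) elim(5), of \<beta> w \<kappa>] elim(3) True
          by (auto simp: exp_add[symmetric] elim!: order_trans)
      next
        case False
        have "(\<beta> / x - \<alpha> * x * (exp (- \<kappa> / x) - 1)) * w \<le> K * w"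
          using False elim(2) by (intro mult_right_mono_neg) auto
        then have "(\<beta> / x - \<alpha> * x * (exp (- \<kappa> / x) - 1)) * w +
            \<alpha> * x\<^sup>2 * (1 - exp (- \<kappa> / x) * (1 - (- \<kappa>) / x)) \<le> K * w + B"
          using elim(4) by linarith
        then show ?thesis
          using bump_le_tangent[OF assms(1,2) elim(5), of \<beta> w "- \<kappa>"] False
          by (auto simp: exp_add[symmetric] add.commute elim!: order_trans)
      qed
    qed
  qed
  then show ?thesis by (intro that[of "exp B"]) auto
qed

section \<open>Exponential substitution in product integrals\<close>

text \<open>Substitution on compact intervals, exhausted on both sides by monotone convergence.
  Working with nonnegative integrals postpones all questions of integrability.\<close>

lemma nn_integral_exp_substitution:
  fixes f :: "real \<Rightarrow> ennreal"
  assumes [measurable]: "f \<in> borel_measurable borel" and "h > 0"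
  shows "(\<integral>\<^sup>+t. f t * indicator {0<..} t \<partial>lborel) =
    (\<integral>\<^sup>+w. f (exp (c + h * w)) * ennreal (h * exp (c + h * w)) \<partial>lborel)"
proof -
  \<comment> \<open>The shift by one keeps the interval from -R n to R n nondegenerate at n =
    0.\<close>
  define R where "R n = real n + 1" for n
  have R_mono: "m \<le> n \<Longrightarrow> R m \<le> R n" for m n by (simp add: R_def)
  define g where "g = (\<lambda>w. exp (c + h * w))"
  have g_mono: "g v \<le> g w \<longleftrightarrow> v \<le> w" for v w
    using assms(2) by (simp add: g_def)
  have "(\<integral>\<^sup>+t. f t * indicator {0<..} t \<partial>lborel) =
      (\<integral>\<^sup>+t. (SUP n::nat. f t * indicator {g (- R n)..g (R n)} t) \<partial>lborel)"
  proof (rule nn_integral_cong)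
    fix t :: real
    show "f t * indicator {0<..} t = (SUP n::nat. f t * indicator {g (- R n)..g (R n)} t)"
    proof (cases "t > 0")
      case False
      then have "t \<notin> {g (- R n)..g (R n)}" for n
        by (auto simp: g_def intro: less_le_trans[OF exp_gt_zero])
      then show ?thesis using False by simp
    next
      case True
      define v where "v = (ln t - c) / h"
      have v: "g v = t" using True assms(2) by (simp add: v_def g_def)
      obtain n where n: "\<bar>v\<bar> \<le> R n" unfolding R_def by (metis real_arch_simple le_add_same_cancel1 order_trans zero_le_one)
      have "t \<in> {g (- R n)..g (R n)}"
        using n unfolding v[symmetric] by (auto simp: g_mono abs_le_iff)
      then have "f t \<le> (SUP n::nat. f t * indicator {g (- R n)..g (R n)} t)"
        by (intro SUP_upper2[of n]) auto
      moreover have "(SUP n::nat. f t * indicator {g (- R n)..g (R n)} t) \<le> f t"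
        by (intro SUP_least) (auto split: split_indicator)
      ultimately show ?thesis using True by simp
    qed
  qed
  also have "\<dots> = (SUP n::nat. \<integral>\<^sup>+t. f t * indicator {g (- R n)..g (R n)} t \<partial>lborel)"
  proof (rule nn_integral_monotone_convergence_SUP)
    have lo: "g (- R n) \<le> t" if "m \<le> n" "g (- R m) \<le> t" for m n t
      using R_mono[OF that(1)] by (intro order_trans[OF _ that(2)]) (simp add: g_mono)
    have hi: "t \<le> g (R n)" if "m \<le> n" "t \<le> g (R m)" for m n t
      using R_mono[OF that(1)] by (intro order_trans[OF that(2)]) (simp add: g_mono)
    show "incseq (\<lambda>n t. f t * indicator {g (- R n)..g (R n)} t)"
      by (auto simp: incseq_def le_fun_def intro: lo hi split: split_indicator)
  qed auto
  also have "\<dots> = (SUP n::nat. \<integral>\<^sup>+w. f (g w) * ennreal (h * exp (c + h * w)) * indicator {- R n..R n} w \<partial>lborel)"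
    unfolding g_def
    by (intro SUP_cong refl nn_integral_substitution_aux)
      (auto simp: R_def less_imp_le[OF assms(2)] intro!: derivative_eq_intros continuous_intros)
  also have "\<dots> = (\<integral>\<^sup>+w. (SUP n::nat. f (g w) * ennreal (h * exp (c + h * w)) * indicator {- R n..R n} w) \<partial>lborel)"
  proof (rule nn_integral_monotone_convergence_SUP[symmetric])
    show "incseq (\<lambda>n w. f (g w) * ennreal (h * exp (c + h * w)) * indicator {- R n..R n} w)"
      by (auto simp: incseq_def le_fun_def dest!: R_mono split: split_indicator)
  qed (auto simp: g_def)
  also have "\<dots> = (\<integral>\<^sup>+w. f (exp (c + h * w)) * ennreal (h * exp (c + h * w)) \<partial>lborel)"
  proof (rule nn_integral_cong)
    fix w :: real
    let ?u = "f (g w) * ennreal (h * exp (c + h * w))"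
    obtain n where n: "\<bar>w\<bar> \<le> R n" unfolding R_def by (metis real_arch_simple le_add_same_cancel1 order_trans zero_le_one)
    then have "?u \<le> (SUP n::nat. ?u * indicator {- R n..R n} w)"
      by (intro SUP_upper2[of n]) (auto simp: abs_le_iff indicator_def)
    moreover have "(SUP n::nat. ?u * indicator {- R n..R n} w) \<le> ?u"
      by (intro SUP_least) (auto split: split_indicator)
    ultimately show "(SUP n::nat. ?u * indicator {- R n..R n} w) =
        f (exp (c + h * w)) * ennreal (h * exp (c + h * w))"
      by (simp add: g_def)
  qed
  finally show ?thesis .
qed

interpretation lborel_product: product_sigma_finite "\<lambda>_. lborel :: real measure"
  by standard

text \<open>Induction on the index set with Tonelli: one coordinate is split off, substituted by the
  one-dimensional lemma and reattached. The indicator appears because the exponential map only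
  reaches the open positive orthant.\<close>

lemma nn_integral_PiM_exp_substitution:
  fixes F :: "('i \<Rightarrow> real) \<Rightarrow> ennreal"
  assumes "finite I" and "F \<in> borel_measurable (PiM I (\<lambda>_. lborel))" and h: "\<And>k. h k > 0"
  shows "(\<integral>\<^sup>+r. F r * indicator {r. \<forall>k\<in>I. 0 < r k} r \<partial>PiM I (\<lambda>_. lborel)) =
    (\<integral>\<^sup>+w. F (\<lambda>k\<in>I. exp (c k + h k * w k)) * (\<Prod>k\<in>I. ennreal (h k * exp (c k + h k * w k)))
      \<partial>PiM I (\<lambda>_. lborel))"
  using assms(1,2)
proof (induction I arbitrary: F rule: finite_induct)
  case empty
  show ?case by (simp add: PiM_empty nn_integral_count_space_finite)
next
  case (insert i I)
  note [measurable] = insert.prems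
  let ?g = "\<lambda>k v. exp (c k + h k * v)"
  let ?M = "\<lambda>I. PiM I (\<lambda>_. lborel :: real measure)"
  have pos [measurable]: "Measurable.pred (?M J) (\<lambda>r. \<forall>k\<in>J. 0 < r k)" if "finite J" for J :: "'i set"
  proof (rule pred_intros_finite(3)[OF that])
    fix k assume "k \<in> J"
    then show "Measurable.pred (?M J) (\<lambda>r. 0 < r k)"
      by (intro measurable_compose[OF measurable_component_singleton]) measurable
  qed
  have fin [simp]: "finite (insert i I)" using insert.hyps by simp
  have meas_upd: "(\<lambda>p. (fst p)(i := q (snd p))) \<in> measurable (?M I \<Otimes>\<^sub>M lborel) (?M (insert i I))"
    if [measurable]: "q \<in> borel_measurable borel" for q :: "real \<Rightarrow> real"
    by measurable
  \<comment> \<open>This partial integral, with coordinate \<open>i\<close> already substituted, is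
    the function to which the induction hypothesis is applied.\<close>
  have meas: "(\<lambda>r. \<integral>\<^sup>+v. F (r(i := ?g i v)) * ennreal (h i * ?g i v) \<partial>lborel) \<in> borel_measurable (?M I)"
    using meas_upd[of "?g i"] by measurable
  have "(\<integral>\<^sup>+r. F r * indicator {r. \<forall>k\<in>insert i I. 0 < r k} r \<partial>?M (insert i I)) =
      (\<integral>\<^sup>+r. (\<integral>\<^sup>+y. F (r(i := y)) * indicator {r. \<forall>k\<in>insert i I. 0 < r k} (r(i := y)) \<partial>lborel) \<partial>?M I)"
    using pos[OF fin]
    by (intro lborel_product.product_nn_integral_insert insert.hyps borel_measurable_times_ennreal
        insert.prems borel_measurable_indicator') (simp add: pred_def)
  also have "\<dots> = (\<integral>\<^sup>+r. (\<integral>\<^sup>+y. F (r(i := y)) * indicator {0<..} y \<partial>lborel) * indicator {r. \<forall>k\<in>I. 0 < r k} r \<partial>?M I)"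
  proof (intro nn_integral_cong)
    fix r assume r: "r \<in> space (?M I)"
    have [measurable]: "(\<lambda>y. F (r(i := y))) \<in> borel_measurable lborel"
      using r by (intro measurable_compose[OF _ insert.prems] measurable_fun_upd) auto
    show "(\<integral>\<^sup>+y. F (r(i := y)) * indicator {r. \<forall>k\<in>insert i I. 0 < r k} (r(i := y)) \<partial>lborel) =
      (\<integral>\<^sup>+y. F (r(i := y)) * indicator {0<..} y \<partial>lborel) * indicator {r. \<forall>k\<in>I. 0 < r k} r"
    proof -
      have "(\<forall>k\<in>insert i I. 0 < (r(i := y)) k) \<longleftrightarrow> 0 < y \<and> (\<forall>k\<in>I. 0 < r k)" for y
        using insert.hyps(2) by force
      then have "(\<integral>\<^sup>+y. F (r(i := y)) * indicator {r. \<forall>k\<in>insert i I. 0 < r k} (r(i := y)) \<partial>lborel) =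
          (\<integral>\<^sup>+y. F (r(i := y)) * indicator {0<..} y * indicator {r. \<forall>k\<in>I. 0 < r k} r \<partial>lborel)"
        by (intro nn_integral_cong) (simp only: indicator_def mem_Collect_eq greaterThan_iff, simp)
      also have "\<dots> = (\<integral>\<^sup>+y. F (r(i := y)) * indicator {0<..} y \<partial>lborel) * indicator {r. \<forall>k\<in>I. 0 < r k} r"
        by (rule nn_integral_multc) measurable
      finally show ?thesis .
    qed
  qed
  also have "\<dots> = (\<integral>\<^sup>+r. (\<integral>\<^sup>+v. F (r(i := ?g i v)) * ennreal (h i * ?g i v) \<partial>lborel) *
      indicator {r. \<forall>k\<in>I. 0 < r k} r \<partial>?M I)"
  proof (rule nn_integral_cong)
    fix r assume r: "r \<in> space (?M I)"
    have [measurable]: "(\<lambda>y. F (r(i := y))) \<in> borel_measurable borel"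
      using measurable_compose[OF measurable_fun_upd insert.prems, of I i "\<lambda>_. r" lborel "\<lambda>y. y"] r by auto
    show "(\<integral>\<^sup>+y. F (r(i := y)) * indicator {0<..} y \<partial>lborel) * indicator {r. \<forall>k\<in>I. 0 < r k} r =
        (\<integral>\<^sup>+v. F (r(i := ?g i v)) * ennreal (h i * ?g i v) \<partial>lborel) * indicator {r. \<forall>k\<in>I. 0 < r k} r"
      by (subst nn_integral_exp_substitution[OF _ h]) auto
  qed
  also have "\<dots> = (\<integral>\<^sup>+w. (\<integral>\<^sup>+v. F ((\<lambda>k\<in>I. ?g k (w k))(i := ?g i v)) * ennreal (h i * ?g i v) \<partial>lborel) *
      (\<Prod>k\<in>I. ennreal (h k * ?g k (w k))) \<partial>?M I)"
    by (rule insert.IH[OF meas])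
  also have "\<dots> = (\<integral>\<^sup>+w. (\<integral>\<^sup>+v. F (\<lambda>k\<in>insert i I. ?g k ((w(i := v)) k)) *
      (\<Prod>k\<in>insert i I. ennreal (h k * ?g k ((w(i := v)) k))) \<partial>lborel) \<partial>?M I)"
  proof (intro nn_integral_cong)
    fix w assume w: "w \<in> space (?M I)"
    have "(\<lambda>k\<in>I. ?g k (w k)) \<in> space (?M I)"
      by (simp add: space_PiM)
    then have [measurable]: "(\<lambda>v. F ((\<lambda>k\<in>I. ?g k (w k))(i := ?g i v))) \<in> borel_measurable lborel"
      by (intro measurable_compose[OF _ insert.prems] measurable_fun_upd) auto
    have eq: "(\<lambda>k\<in>I. ?g k (w k))(i := ?g i v) = (\<lambda>k\<in>insert i I. ?g k ((w(i := v)) k))" for v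
      using insert.hyps by (auto simp: fun_eq_iff)
    show "(\<integral>\<^sup>+v. F ((\<lambda>k\<in>I. ?g k (w k))(i := ?g i v)) * ennreal (h i * ?g i v) \<partial>lborel) *
        (\<Prod>k\<in>I. ennreal (h k * ?g k (w k))) =
      (\<integral>\<^sup>+v. F (\<lambda>k\<in>insert i I. ?g k ((w(i := v)) k)) *
        (\<Prod>k\<in>insert i I. ennreal (h k * ?g k ((w(i := v)) k))) \<partial>lborel)"
    proof -
      have "(\<Prod>k\<in>I. ennreal (h k * ?g k ((w(i := v)) k))) = (\<Prod>k\<in>I. ennreal (h k * ?g k (w k)))" for v
        using insert.hyps(2) by (intro prod.cong) auto
      then have "(\<Prod>k\<in>insert i I. ennreal (h k * ?g k ((w(i := v)) k))) =
          ennreal (h i * ?g i v) * (\<Prod>k\<in>I. ennreal (h k * ?g k (w k)))" for v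
        by (simp only: prod.insert[OF insert.hyps] fun_upd_same)
      then show ?thesis
        unfolding eq[symmetric] by (subst nn_integral_multc[symmetric]) (auto simp only: mult.assoc, measurable)
    qed
  qed
  also have "\<dots> = (\<integral>\<^sup>+w. F (\<lambda>k\<in>insert i I. ?g k (w k)) *
      (\<Prod>k\<in>insert i I. ennreal (h k * ?g k (w k))) \<partial>?M (insert i I))"
    by (intro lborel_product.product_nn_integral_insert[symmetric] insert.hyps) measurable
  finally show ?case .
qed

section \<open>Moment generating function of the profile\<close>

text \<open>The profile is normalised to height 1 at w = 0, not to mass 1, so the value at s = 0 is
  its mass. As a Bochner integral this is 0 where the integral diverges, hence the integrability
  premise in the lower bound further down.\<close>

definition bump_mgf :: "real \<Rightarrow> real \<Rightarrow> real \<Rightarrow> real \<Rightarrow> real \<Rightarrow> real" where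
  "bump_mgf \<alpha> \<tau> \<beta> x s = (\<integral>w. bump \<alpha> \<tau> \<beta> x w * exp (s * w) \<partial>lborel)"

lemma integrable_exp_neg_abs: "integrable lborel (\<lambda>w::real. exp (- \<bar>w\<bar>))"
proof -
  have pos: "integrable lborel (\<lambda>w::real. indicator {0<..} w * exp (- w))"
    using integrable_I0i_exp_mscale[of 1] by (simp add: set_integrable_def)
  then have "integrable lborel (\<lambda>w::real. indicator {0<..} (- w) * exp (- (- w)))"
    using lborel_integrable_real_affine_iff[of "-1" "\<lambda>w::real. indicator {0<..} w * exp (- w) :: real" 0]
    by simp
  from Bochner_Integration.integrable_add[OF pos this]
  show ?thesis
    by (rule integrable_cong_AE_imp)
      (auto intro!: AE_I[where N = "{0}"] simp: indicator_def split: if_splits)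
qed

text \<open>Completing the square: tilting a centred Gaussian by s moves its mean to v s.\<close>

lemma gaussian_eq_normal_density:
  assumes "v > 0"
  shows "exp (- w\<^sup>2 / (2 * v)) * exp (s * w) =
    sqrt (2 * pi * v) * exp (v * s\<^sup>2 / 2) * normal_density (v * s) (sqrt v) w"
  using assms
  by (simp add: normal_density_def exp_add[symmetric])
    (simp add: field_simps power2_eq_square)

lemma integral_gaussian_mgf:
  assumes "v > 0"
  shows "(\<integral>w. exp (- w\<^sup>2 / (2 * v)) * exp (s * w) \<partial>lborel) = sqrt (2 * pi * v) * exp (v * s\<^sup>2 / 2)"
  using assms unfolding gaussian_eq_normal_density[OF assms] by simp

text \<open>The argument \<open>S N\<close> varies with N because the Riemann sum evaluates the
  generating function at lattice points that only converge to s.\<close>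

lemma bump_mgf_tendsto:
  assumes "\<alpha> > 0" "\<tau> > 0" and X: "filterlim X at_top sequentially" and S: "S \<longlonglongrightarrow> s"
  shows "(\<lambda>N. bump_mgf \<alpha> \<tau> \<beta> (X N) (S N)) \<longlonglongrightarrow>
    sqrt (2 * pi * bump_var \<alpha> \<tau>) * exp (bump_var \<alpha> \<tau> * s\<^sup>2 / 2)"
proof -
  \<comment> \<open>Eventually |S N| < |s| + 1 = K - 1, so the decay exp (-K |w|) beats the tilt and
    leaves exp (-|w|).\<close>
  define K where "K = \<bar>s\<bar> + 2"
  have "K > 0" by (simp add: K_def)
  obtain C where C: "C > 0" "\<forall>\<^sub>F x in at_top. \<forall>w. bump \<alpha> \<tau> \<beta> x w \<le> C * exp (- K * \<bar>w\<bar>)"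
    using bump_bound[OF assms(1,2) \<open>K > 0\<close>] .
  have "\<forall>\<^sub>F N in sequentially. \<bar>S N\<bar> < K - 1"
    by (rule order_tendstoD(2)[OF tendsto_rabs[OF S]]) (simp add: K_def)
  with eventually_compose_filterlim[OF C(2) X]
  have bound: "\<forall>\<^sub>F N in sequentially. \<forall>w\<in>space lborel.
      \<bar>bump \<alpha> \<tau> \<beta> (X N) w * exp (S N * w)\<bar> \<le> C * exp (- \<bar>w\<bar>)"
  proof eventually_elim
    case (elim N)
    show ?case
    proof
      fix w :: real
      have "S N * w \<le> \<bar>S N\<bar> * \<bar>w\<bar>"
        by (metis abs_ge_self abs_mult)
      also have "\<dots> \<le> (K - 1) * \<bar>w\<bar>"
        using elim(2) by (intro mult_right_mono) auto
      finally have "exp (S N * w) \<le> exp ((K - 1) * \<bar>w\<bar>)"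
        by simp
      then have "bump \<alpha> \<tau> \<beta> (X N) w * exp (S N * w) \<le> C * exp (- K * \<bar>w\<bar>) * exp ((K - 1) * \<bar>w\<bar>)"
        using elim(1) C(1) by (intro mult_mono) (auto simp: bump_nonneg)
      also have "\<dots> = C * exp (- \<bar>w\<bar>)"
        by (simp add: exp_add[symmetric] algebra_simps)
      finally show "\<bar>bump \<alpha> \<tau> \<beta> (X N) w * exp (S N * w)\<bar> \<le> C * exp (- \<bar>w\<bar>)"
        by (simp add: bump_nonneg)
    qed
  qed
  have "(\<lambda>N. bump_mgf \<alpha> \<tau> \<beta> (X N) (S N)) \<longlonglongrightarrow>
      (\<integral>w. exp (- w\<^sup>2 / (2 * bump_var \<alpha> \<tau>)) * exp (s * w) \<partial>lborel)"
    unfolding bump_mgf_def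
  proof (rule dominated_convergence_eventually(1)[OF _ _ _ _ bound])
    fix w :: real
    show "(\<lambda>N. bump \<alpha> \<tau> \<beta> (X N) w * exp (S N * w)) \<longlonglongrightarrow>
        exp (- w\<^sup>2 / (2 * bump_var \<alpha> \<tau>)) * exp (s * w)"
      by (intro tendsto_intros S filterlim_compose[OF bump_tendsto X] assms)
  qed (use integrable_exp_neg_abs in auto)
  then show ?thesis
    by (simp only: integral_gaussian_mgf[OF bump_var_pos[OF assms(1,2)]])
qed

text \<open>On [1, 2] for s >= 0, and on [-2, -1] for s < 0, one has s w >= |s|. The mass of the
  profile on either interval tends to a positive Gaussian mass and is therefore bounded below for
  large N, uniformly in s. The reciprocal bound is the majorant for the sum over l.\<close>

lemma bump_mgf_lower_bound:
  assumes "\<alpha> > 0" "\<tau> > 0" and X: "filterlim X at_top sequentially"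
  obtains c where "c > 0" "\<forall>\<^sub>F N in sequentially. \<forall>s.
    integrable lborel (\<lambda>w. bump \<alpha> \<tau> \<beta> (X N) w * exp (s * w)) \<longrightarrow>
    c * exp \<bar>s\<bar> \<le> bump_mgf \<alpha> \<tau> \<beta> (X N) s"
proof -
  define G where "G = (\<lambda>w. exp (- w\<^sup>2 / (2 * bump_var \<alpha> \<tau>)))"
  obtain C where C: "C > 0" "\<forall>\<^sub>F x in at_top. \<forall>w. bump \<alpha> \<tau> \<beta> x w \<le> C * exp (- \<bar>w\<bar>)"
    using bump_bound[OF assms(1,2), of 1 \<beta>] by auto
  have *: "\<exists>c>0. \<forall>\<^sub>F N in sequentially. integrable lborel (\<lambda>w. indicator A w * bump \<alpha> \<tau> \<beta> (X N) w) \<and>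
      c < (\<integral>w. indicator A w * bump \<alpha> \<tau> \<beta> (X N) w \<partial>lborel)"
    if A: "A = {a..a + 1}" for A :: "real set" and a :: real
  proof -
    have meas [measurable]: "A \<in> sets borel" by (simp add: A)
    have lim: "(\<lambda>N. indicator A w * bump \<alpha> \<tau> \<beta> (X N) w) \<longlonglongrightarrow> indicator A w * G w" for w
      unfolding G_def by (intro tendsto_intros filterlim_compose[OF bump_tendsto X] assms)
    have bound: "\<forall>\<^sub>F N in sequentially. \<forall>w\<in>space lborel.
        \<bar>indicator A w * bump \<alpha> \<tau> \<beta> (X N) w\<bar> \<le> C * exp (- \<bar>w\<bar>)"
      using eventually_compose_filterlim[OF C(2) X]
      by eventually_elim (use C(1) in \<open>auto simp: indicator_def bump_nonneg\<close>)
    note dc = dominated_convergence_eventually[of "\<lambda>N w. indicator A w * bump \<alpha> \<tau> \<beta> (X N) w" lborel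
        "\<lambda>w. indicator A w * G w" "\<lambda>w. C * exp (- \<bar>w\<bar>)", OF _ _ _ lim bound]
    have int: "integrable lborel (\<lambda>w. indicator A w * G w)"
      by (rule dc(3)) (use integrable_exp_neg_abs in \<open>auto simp: G_def\<close>)
    define c where "c = (\<integral>w. indicator A w * G w \<partial>lborel)"
    \<comment> \<open>The Gaussian is positive everywhere and the interval has length 1.\<close>
    have "c > 0"
    proof -
      have "c \<noteq> 0"
      proof
        assume "c = 0"
        then have "AE w in lborel. indicator A w * G w = 0"
          unfolding c_def using integral_nonneg_eq_0_iff_AE[OF int] by (auto simp: G_def)
        then have "AE w in lborel. w \<notin> A"
          by eventually_elim (auto simp: indicator_def G_def)
        then have "emeasure lborel A = 0"
          by (subst (asm) AE_iff_measurable[of A]) auto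
        then show False by (simp add: A)
      qed
      moreover have "c \<ge> 0"
        unfolding c_def by (intro integral_nonneg_AE) (auto simp: G_def)
      ultimately show ?thesis by simp
    qed
    moreover have "\<forall>\<^sub>F N in sequentially. c / 2 < (\<integral>w. indicator A w * bump \<alpha> \<tau> \<beta> (X N) w \<partial>lborel)"
      by (rule order_tendstoD(1)[OF dc(1)])
        (use integrable_exp_neg_abs \<open>c > 0\<close> in \<open>auto simp: G_def c_def\<close>)
    moreover have "\<forall>\<^sub>F N in sequentially. integrable lborel (\<lambda>w. indicator A w * bump \<alpha> \<tau> \<beta> (X N) w)"
      by (rule dc(2)) (use integrable_exp_neg_abs in \<open>auto simp: G_def\<close>)
    ultimately show ?thesis
      by (intro exI[of _ "c / 2"] conjI eventually_conj) auto
  qed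
  obtain c1 where c1: "c1 > 0" "\<forall>\<^sub>F N in sequentially.
      integrable lborel (\<lambda>w. indicator {1..1 + 1} w * bump \<alpha> \<tau> \<beta> (X N) w) \<and>
      c1 < (\<integral>w. indicator {1..1 + 1} w * bump \<alpha> \<tau> \<beta> (X N) w \<partial>lborel)"
    using *[OF refl, of 1] by blast
  obtain c2 where c2: "c2 > 0" "\<forall>\<^sub>F N in sequentially.
      integrable lborel (\<lambda>w. indicator {-2..-2 + 1} w * bump \<alpha> \<tau> \<beta> (X N) w) \<and>
      c2 < (\<integral>w. indicator {-2..-2 + 1} w * bump \<alpha> \<tau> \<beta> (X N) w \<partial>lborel)"
    using *[OF refl, of "-2"] by blast
  have half: "c * exp \<bar>s\<bar> \<le> bump_mgf \<alpha> \<tau> \<beta> x s"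
    if "integrable lborel (\<lambda>w. indicator A w * bump \<alpha> \<tau> \<beta> x w)"
      and c: "c \<le> (\<integral>w. indicator A w * bump \<alpha> \<tau> \<beta> x w \<partial>lborel)"
      and "integrable lborel (\<lambda>w. bump \<alpha> \<tau> \<beta> x w * exp (s * w))"
      and A: "\<And>w. w \<in> A \<Longrightarrow> \<bar>s\<bar> \<le> s * w" for A x s c
  proof -
    have "c * exp \<bar>s\<bar> \<le> (\<integral>w. indicator A w * bump \<alpha> \<tau> \<beta> x w \<partial>lborel) * exp \<bar>s\<bar>"
      using c by simp
    also have "\<dots> = (\<integral>w. indicator A w * bump \<alpha> \<tau> \<beta> x w * exp \<bar>s\<bar> \<partial>lborel)"
      by simp
    also have "\<dots> \<le> bump_mgf \<alpha> \<tau> \<beta> x s"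
      unfolding bump_mgf_def
      by (rule integral_mono)
        (use that in \<open>auto simp: indicator_def bump_nonneg intro!: mult_left_mono\<close>)
    finally show ?thesis .
  qed
  have "\<forall>\<^sub>F N in sequentially. \<forall>s.
    integrable lborel (\<lambda>w. bump \<alpha> \<tau> \<beta> (X N) w * exp (s * w)) \<longrightarrow>
    min c1 c2 * exp \<bar>s\<bar> \<le> bump_mgf \<alpha> \<tau> \<beta> (X N) s"
    using c1(2) c2(2)
  proof eventually_elim
    case (elim N)
    show ?case
    proof (intro allI impI)
      fix s assume int: "integrable lborel (\<lambda>w. bump \<alpha> \<tau> \<beta> (X N) w * exp (s * w))"
      show "min c1 c2 * exp \<bar>s\<bar> \<le> bump_mgf \<alpha> \<tau> \<beta> (X N) s"
      proof (cases "s \<ge> 0")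
        case True
        show ?thesis
          by (rule half[of "{1..1 + 1}"])
            (use elim int True mult_left_mono[of 1 _ s] in auto)
      next
        case False
        show ?thesis
          by (rule half[of "{-2..-2 + 1}"])
            (use elim int False mult_left_mono_neg[of _ "-1" s] in auto)
      qed
    qed
  qed
  then show ?thesis
    using c1(1) c2(1) by (intro that[of "min c1 c2"]) auto
qed

text \<open>The substitution u = \<rho> exp (w / x) leads back to the Beta integral. With x = sqrt
  N, \<alpha> = \<sigma> k + t, \<beta> = b k + 1 and s = (l - t N) / sqrt N the first Beta
  parameter \<open>a\<close> is \<sigma> k N + b k + 1 + l, in which t no longer occurs.\<close>

lemma
  assumes "\<alpha> > 0" "\<tau> > 0" "x > 0" and a: "\<alpha> * x\<^sup>2 + \<beta> + s * x = a" "a > 0"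
  defines "\<rho> \<equiv> \<alpha> / (\<alpha> + \<tau>)"
  shows bump_mgf_eq_Beta:
      "bump_mgf \<alpha> \<tau> \<beta> x s = x * Beta a (\<tau> * x\<^sup>2 + 1) / (\<rho> powr a * (1 - \<rho>) powr (\<tau> * x\<^sup>2))"
    and integrable_bump_mgf: "integrable lborel (\<lambda>w. bump \<alpha> \<tau> \<beta> x w * exp (s * w))"
proof -
  define c where "c = \<tau> * x\<^sup>2"
  have c: "c > 0" using assms by (simp add: c_def)
  have \<rho>: "0 < \<rho>" "\<rho> < 1" "1 - \<rho> = \<tau> / (\<alpha> + \<tau>)"
    using assms by (auto simp: \<rho>_def field_simps)
  \<comment> \<open>\<open>D\<close> is the integrand after substitution, Jacobian included, at w =
    0, that is, the factor removed when the profile is normalised to height 1.\<close>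
  define D where "D = \<rho> powr a * (1 - \<rho>) powr c / x"
  have D: "D > 0" using \<rho> assms by (simp add: D_def)
  let ?f = "\<lambda>t. indicator {0..1} t * (t powr (a - 1) * (1 - t) powr c)"
  have beta: "((\<lambda>t. t powr (a - 1) * (1 - t) powr c) has_integral Beta a (c + 1)) {0..1}"
    using has_integral_Beta_real[of a "c + 1"] a c by simp
  have pointwise: "?f (exp (ln \<rho> + 1 / x * w)) * (1 / x * exp (ln \<rho> + 1 / x * w)) =
      D * (bump \<alpha> \<tau> \<beta> x w * exp (s * w))" for w
  proof -
    define t where "t = exp (ln \<rho> + 1 / x * w)"
    have t: "t = \<rho> * exp (w / x)" using \<rho> by (simp add: t_def exp_add)
    have cond: "\<alpha> * exp (w / x) < \<alpha> + \<tau> \<longleftrightarrow> t < 1"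
      using assms by (simp add: t \<rho>_def field_simps)
    show ?thesis
    proof (cases "t < 1")
      case False
      then have "?f t = 0" using c by (auto simp: indicator_def)
      then show ?thesis using False cond unfolding t_def[symmetric] by (simp add: bump_def)
    next
      case True
      have tpos: "t > 0" by (simp add: t_def)
      have "(\<alpha> + \<tau> - \<alpha> * exp (w / x)) / \<tau> = (1 - t) / (1 - \<rho>)"
      proof -
        have "1 - t = (\<alpha> + \<tau> - \<alpha> * exp (w / x)) / (\<alpha> + \<tau>)"
          using assms by (simp add: t \<rho>_def field_simps)
        then show ?thesis unfolding \<rho>(3) using assms by simp
      qed
      then have p: "((\<alpha> + \<tau> - \<alpha> * exp (w / x)) / \<tau>) powr c = (1 - t) powr c / (1 - \<rho>) powr c"
        using True \<rho>(2) by (simp only: powr_divide)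
      have "(\<alpha> * x\<^sup>2 + \<beta>) * w / x + s * w = a * (w / x)"
        using assms(3) by (simp add: a(1)[symmetric] field_simps power2_eq_square)
      then have e: "exp ((\<alpha> * x\<^sup>2 + \<beta>) * w / x) * exp (s * w) = exp (a * (w / x))"
        by (simp add: exp_add[symmetric])
      have "t powr (a - 1) * t = t powr a"
        using tpos by (simp add: powr_diff)
      also have "\<dots> = \<rho> powr a * exp (a * (w / x))"
        using \<rho> by (simp add: t powr_mult) (simp add: powr_def)
      finally have q: "t powr (a - 1) * t = \<rho> powr a * exp (a * (w / x))" .
      have "?f t * (1 / x * t) = (t powr (a - 1) * t) * (1 - t) powr c / x"
        using True tpos by simp
      also have "\<dots> = D * (exp (a * (w / x)) * ((1 - t) powr c / (1 - \<rho>) powr c))"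
        unfolding q D_def using \<rho> assms(1-3) by simp
      also have "\<dots> = D * (bump \<alpha> \<tau> \<beta> x w * exp (s * w))"
        unfolding e[symmetric] using True cond by (simp add: bump_def c_def[symmetric] p)
      finally show ?thesis by (simp add: t_def)
    qed
  qed
  have "ennreal (Beta a (c + 1)) = (\<integral>\<^sup>+t. ennreal (?f t) \<partial>lborel)"
    using nn_integral_has_integral_lebesgue[OF _ beta] by simp
  also have "\<dots> = (\<integral>\<^sup>+t. ennreal (?f t) * indicator {0<..} t \<partial>lborel)"
    by (rule nn_integral_cong) (auto simp: indicator_def)
  also have "\<dots> = (\<integral>\<^sup>+w. ennreal (?f (exp (ln \<rho> + 1 / x * w))) * ennreal (1 / x * exp (ln \<rho> + 1 / x * w)) \<partial>lborel)"
    by (rule nn_integral_exp_substitution) (use assms in auto)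
  also have "\<dots> = (\<integral>\<^sup>+w. ennreal (D * (bump \<alpha> \<tau> \<beta> x w * exp (s * w))) \<partial>lborel)"
    by (subst ennreal_mult'[symmetric]) (use assms pointwise in simp_all)
  finally have nn: "(\<integral>\<^sup>+w. ennreal (D * (bump \<alpha> \<tau> \<beta> x w * exp (s * w))) \<partial>lborel) = ennreal (Beta a (c + 1))"
    by simp
  have nonneg: "0 \<le> D * (bump \<alpha> \<tau> \<beta> x w * exp (s * w))" for w
    using D by (simp add: bump_nonneg)
  \<comment> \<open>Integrability is a consequence of the evaluation: the nonnegative integral is a
    finite Beta value.\<close>
  have "integrable lborel (\<lambda>w. D * (bump \<alpha> \<tau> \<beta> x w * exp (s * w)))"
    by (rule integrableI_nonneg) (use nonneg nn in auto)
  then show "integrable lborel (\<lambda>w. bump \<alpha> \<tau> \<beta> x w * exp (s * w))"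
    using D by simp
  have "(\<integral>w. D * (bump \<alpha> \<tau> \<beta> x w * exp (s * w)) \<partial>lborel) = Beta a (c + 1)"
    using nonneg nn has_integral_nonneg[OF beta] by (subst integral_eq_nn_integral) auto
  then have "D * bump_mgf \<alpha> \<tau> \<beta> x s = Beta a (c + 1)"
    by (simp add: bump_mgf_def)
  then show "bump_mgf \<alpha> \<tau> \<beta> x s = x * Beta a (\<tau> * x\<^sup>2 + 1) / (\<rho> powr a * (1 - \<rho>) powr (\<tau> * x\<^sup>2))"
    using D \<rho> assms by (simp add: D_def c_def[symmetric] field_simps)
qed

section \<open>Convolution and summation of profiles\<close>

text \<open>This is the density at y of a sum of independent centred normals, whose variances add.
  Integrating out coordinate \<open>i\<close> is a convolution that merges \<open>v i\<close> into
  \<open>u\<close>, so \<open>u\<close> is generalised in the induction.\<close>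

lemma nn_integral_normal_density_convolution:
  fixes v :: "'i \<Rightarrow> real"
  assumes "finite I" and "\<And>k. k \<in> I \<Longrightarrow> v k > 0" and "u > 0"
  shows "(\<integral>\<^sup>+w. ennreal ((\<Prod>k\<in>I. normal_density 0 (sqrt (v k)) (w k)) *
      normal_density 0 (sqrt u) (y - (\<Sum>k\<in>I. w k))) \<partial>PiM I (\<lambda>_. lborel)) =
    ennreal (normal_density 0 (sqrt (u + (\<Sum>k\<in>I. v k))) y)"
  using assms
proof (induction I arbitrary: u y rule: finite_induct)
  case empty
  show ?case by (simp add: PiM_empty nn_integral_count_space_finite)
next
  case (insert i I)
  let ?M = "PiM I (\<lambda>_. lborel :: real measure)"
  let ?P = "\<lambda>w. \<Prod>k\<in>I. normal_density 0 (sqrt (v k)) (w k)"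
  have vi: "v i > 0" using insert.prems by simp
  have "(\<integral>\<^sup>+w. ennreal ((\<Prod>k\<in>insert i I. normal_density 0 (sqrt (v k)) (w k)) *
      normal_density 0 (sqrt u) (y - (\<Sum>k\<in>insert i I. w k))) \<partial>PiM (insert i I) (\<lambda>_. lborel)) =
    (\<integral>\<^sup>+w. (\<integral>\<^sup>+t. ennreal ((\<Prod>k\<in>insert i I. normal_density 0 (sqrt (v k)) ((w(i := t)) k)) *
      normal_density 0 (sqrt u) (y - (\<Sum>k\<in>insert i I. (w(i := t)) k))) \<partial>lborel) \<partial>?M)"
    by (intro lborel_product.product_nn_integral_insert insert.hyps) measurable
  also have "\<dots> = (\<integral>\<^sup>+w. ennreal (?P w * normal_density 0 (sqrt (u + v i)) (y - (\<Sum>k\<in>I. w k))) \<partial>?M)"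
  proof (rule nn_integral_cong)
    fix w :: "'i \<Rightarrow> real"
    have P: "(\<Prod>k\<in>insert i I. normal_density 0 (sqrt (v k)) ((w(i := t)) k)) =
        normal_density 0 (sqrt (v i)) t * ?P w" for t
    proof -
      have "(\<Prod>k\<in>I. normal_density 0 (sqrt (v k)) ((w(i := t)) k)) = ?P w"
        using insert.hyps(2) by (intro prod.cong) auto
      then show ?thesis by (simp only: prod.insert[OF insert.hyps(1,2)] fun_upd_same)
    qed
    have S: "(\<Sum>k\<in>insert i I. (w(i := t)) k) = t + (\<Sum>k\<in>I. w k)" for t
    proof -
      have "(\<Sum>k\<in>I. (w(i := t)) k) = (\<Sum>k\<in>I. w k)"
        using insert.hyps(2) by (intro sum.cong) auto
      then show ?thesis by (simp only: sum.insert[OF insert.hyps(1,2)] fun_upd_same)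
    qed
    have conv: "(\<integral>\<^sup>+t. ennreal (normal_density 0 (sqrt u) (z - t) * normal_density 0 (sqrt (v i)) t) \<partial>lborel) =
        ennreal (normal_density 0 (sqrt (u + v i)) z)" for z
      using fun_cong[OF conv_normal_density_zero_mean[of "sqrt u" "sqrt (v i)"], of z] vi insert.prems(2)
      by simp
    have "(\<integral>\<^sup>+t. ennreal ((\<Prod>k\<in>insert i I. normal_density 0 (sqrt (v k)) ((w(i := t)) k)) *
        normal_density 0 (sqrt u) (y - (\<Sum>k\<in>insert i I. (w(i := t)) k))) \<partial>lborel) =
      (\<integral>\<^sup>+t. ennreal (?P w) * ennreal (normal_density 0 (sqrt u) ((y - (\<Sum>k\<in>I. w k)) - t) *
        normal_density 0 (sqrt (v i)) t) \<partial>lborel)"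
      unfolding P S
      by (intro nn_integral_cong)
        (simp add: ennreal_mult'[symmetric] prod_nonneg mult_ac diff_diff_eq add.commute)
    also have "\<dots> = ennreal (?P w) * (\<integral>\<^sup>+t. ennreal (normal_density 0 (sqrt u) ((y - (\<Sum>k\<in>I. w k)) - t) *
        normal_density 0 (sqrt (v i)) t) \<partial>lborel)"
      by (rule nn_integral_cmult) measurable
    also have "\<dots> = ennreal (?P w * normal_density 0 (sqrt (u + v i)) (y - (\<Sum>k\<in>I. w k)))"
      unfolding conv by (simp add: ennreal_mult'[symmetric] prod_nonneg)
    finally show "(\<integral>\<^sup>+t. ennreal ((\<Prod>k\<in>insert i I. normal_density 0 (sqrt (v k)) ((w(i := t)) k)) *
        normal_density 0 (sqrt u) (y - (\<Sum>k\<in>insert i I. (w(i := t)) k))) \<partial>lborel) =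
      ennreal (?P w * normal_density 0 (sqrt (u + v i)) (y - (\<Sum>k\<in>I. w k)))" .
  qed
  also have "\<dots> = ennreal (normal_density 0 (sqrt (u + v i + (\<Sum>k\<in>I. v k))) y)"
    by (rule insert.IH) (use insert.prems add_pos_pos[OF insert.prems(2) vi] in auto)
  finally show ?case using insert.hyps by (simp add: add.assoc)
qed

text \<open>This is the convolution of all profiles over \<open>insert m I\<close>, evaluated at 0:
  the variable of index \<open>m\<close> is eliminated by the condition that all variables sum to 0,
  just as the weight has only m - 1 integration variables. For empty \<open>I\<close> the value is
  1.\<close>

definition bump_conv :: "('i \<Rightarrow> real) \<Rightarrow> ('i \<Rightarrow> real) \<Rightarrow> ('i \<Rightarrow> real) \<Rightarrow> 'i set \<Rightarrow> 'i \<Rightarrow> real \<Rightarrow> real" where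
  "bump_conv \<alpha> \<tau> \<beta> I m x =
    (\<integral>w. (\<Prod>k\<in>I. bump (\<alpha> k) (\<tau> k) (\<beta> k) x (w k)) * bump (\<alpha> m) (\<tau> m) (\<beta> m) x (- (\<Sum>k\<in>I. w k))
      \<partial>PiM I (\<lambda>_. lborel))"

text \<open>Each limit profile is sqrt (2 pi v) times a centred normal density; the convolution of
  these densities has the total variance V and takes the value 1 / sqrt (2 pi V) at 0.\<close>

lemma bump_conv_tendsto:
  fixes \<alpha> \<tau> \<beta> :: "'i \<Rightarrow> real"
  assumes I: "finite I" "m \<notin> I" and pos: "\<And>k. k \<in> insert m I \<Longrightarrow> \<alpha> k > 0" "\<And>k. k \<in> insert m I \<Longrightarrow> \<tau> k > 0"
    and X: "filterlim X at_top sequentially"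
  defines "v \<equiv> \<lambda>k. bump_var (\<alpha> k) (\<tau> k)"
  shows "(\<lambda>N. bump_conv \<alpha> \<tau> \<beta> I m (X N)) \<longlonglongrightarrow>
    (\<Prod>k\<in>insert m I. sqrt (2 * pi * v k)) / sqrt (2 * pi * (\<Sum>k\<in>insert m I. v k))"
proof -
  let ?M = "PiM I (\<lambda>_. lborel :: real measure)"
  let ?b = "\<lambda>k. bump (\<alpha> k) (\<tau> k) (\<beta> k)"
  let ?g = "\<lambda>k w. exp (- w\<^sup>2 / (2 * v k))"
  let ?n = "\<lambda>k. normal_density 0 (sqrt (v k))"
  have v: "v k > 0" if "k \<in> insert m I" for k
    using that pos by (simp add: v_def bump_var_pos)
  have "\<exists>C>0. \<forall>\<^sub>F x in at_top. \<forall>w. ?b k x w \<le> C * exp (- \<bar>w\<bar>)" if "k \<in> insert m I" for k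
    using bump_bound[OF pos[OF that], of 1 "\<beta> k"] by auto
  then obtain C where C: "\<And>k. k \<in> insert m I \<Longrightarrow> C k > 0"
    "\<And>k. k \<in> insert m I \<Longrightarrow> \<forall>\<^sub>F x in at_top. \<forall>w. ?b k x w \<le> C k * exp (- \<bar>w\<bar>)"
    by metis
  have "\<forall>\<^sub>F x in at_top. \<forall>k\<in>insert m I. \<forall>w. ?b k x w \<le> C k * exp (- \<bar>w\<bar>)"
    using I C(2) by (intro eventually_ball_finite) auto
  from eventually_compose_filterlim[OF this X]
  have bound: "\<forall>\<^sub>F N in sequentially. \<forall>w\<in>space ?M.
      \<bar>(\<Prod>k\<in>I. ?b k (X N) (w k)) * ?b m (X N) (- (\<Sum>k\<in>I. w k))\<bar> \<le> (\<Prod>k\<in>I. C k * exp (- \<bar>w k\<bar>)) * C m"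
  proof eventually_elim
    case (elim N)
    show ?case
    proof
      fix w :: "'i \<Rightarrow> real"
      have "?b m (X N) (- (\<Sum>k\<in>I. w k)) \<le> C m * exp (- \<bar>- (\<Sum>k\<in>I. w k)\<bar>)"
        using elim by blast
      \<comment> \<open>The other factors already give an integrable majorant, so a constant is
        enough for index \<open>m\<close>.\<close>
      also have "\<dots> \<le> C m * 1"
        using C(1)[of m] by (intro mult_left_mono) auto
      finally have "?b m (X N) (- (\<Sum>k\<in>I. w k)) \<le> C m" by simp
      moreover have "(\<Prod>k\<in>I. ?b k (X N) (w k)) \<le> (\<Prod>k\<in>I. C k * exp (- \<bar>w k\<bar>))"
        using elim by (intro prod_mono) (auto simp: bump_nonneg)
      ultimately have "(\<Prod>k\<in>I. ?b k (X N) (w k)) * ?b m (X N) (- (\<Sum>k\<in>I. w k)) \<le>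
          (\<Prod>k\<in>I. C k * exp (- \<bar>w k\<bar>)) * C m"
        using C(1) by (intro mult_mono prod_nonneg) (auto simp: bump_nonneg intro!: mult_nonneg_nonneg less_imp_le)
      then show "\<bar>(\<Prod>k\<in>I. ?b k (X N) (w k)) * ?b m (X N) (- (\<Sum>k\<in>I. w k))\<bar> \<le>
          (\<Prod>k\<in>I. C k * exp (- \<bar>w k\<bar>)) * C m"
        by (simp add: bump_nonneg prod_nonneg)
    qed
  qed
  have int: "integrable ?M (\<lambda>w. (\<Prod>k\<in>I. C k * exp (- \<bar>w k\<bar>)) * C m)"
    by (intro integrable_mult_left lborel_product.product_integrable_prod I
        integrable_mult_right integrable_exp_neg_abs)
  have "(\<lambda>N. bump_conv \<alpha> \<tau> \<beta> I m (X N)) \<longlonglongrightarrow>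
      (\<integral>w. (\<Prod>k\<in>I. ?g k (w k)) * ?g m (- (\<Sum>k\<in>I. w k)) \<partial>?M)"
    unfolding bump_conv_def
  proof (rule dominated_convergence_eventually(1)[OF _ _ int _ bound])
    fix w :: "'i \<Rightarrow> real"
    show "(\<lambda>N. (\<Prod>k\<in>I. ?b k (X N) (w k)) * ?b m (X N) (- (\<Sum>k\<in>I. w k))) \<longlonglongrightarrow>
        (\<Prod>k\<in>I. ?g k (w k)) * ?g m (- (\<Sum>k\<in>I. w k))"
      unfolding v_def
      by (intro tendsto_mult tendsto_prod filterlim_compose[OF bump_tendsto X] pos) auto
  qed measurable
  moreover have "(\<integral>w. (\<Prod>k\<in>I. ?g k (w k)) * ?g m (- (\<Sum>k\<in>I. w k)) \<partial>?M) =
      (\<Prod>k\<in>insert m I. sqrt (2 * pi * v k)) * (\<integral>w. (\<Prod>k\<in>I. ?n k (w k)) * ?n m (0 - (\<Sum>k\<in>I. w k)) \<partial>?M)"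
  proof -
    have g: "?g k w = sqrt (2 * pi * v k) * ?n k w" if "k \<in> insert m I" for k w
      using gaussian_eq_normal_density[OF v[OF that], of w 0] by simp
    have "(\<Prod>k\<in>I. ?g k (w k)) * ?g m (- (\<Sum>k\<in>I. w k)) =
        (\<Prod>k\<in>insert m I. sqrt (2 * pi * v k)) * ((\<Prod>k\<in>I. ?n k (w k)) * ?n m (0 - (\<Sum>k\<in>I. w k)))" for w
    proof -
      have "(\<Prod>k\<in>I. ?g k (w k)) = (\<Prod>k\<in>I. sqrt (2 * pi * v k)) * (\<Prod>k\<in>I. ?n k (w k))"
        unfolding prod.distrib[symmetric] by (intro prod.cong refl g) auto
      moreover have "?g m (- (\<Sum>k\<in>I. w k)) = sqrt (2 * pi * v m) * ?n m (0 - (\<Sum>k\<in>I. w k))"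
        using g[of m "- (\<Sum>k\<in>I. w k)"] by simp
      ultimately show ?thesis
        by (simp only: prod.insert[OF I] mult_ac)
    qed
    then show ?thesis by simp
  qed
  moreover have "(\<integral>w. (\<Prod>k\<in>I. ?n k (w k)) * ?n m (0 - (\<Sum>k\<in>I. w k)) \<partial>?M) =
      1 / sqrt (2 * pi * (\<Sum>k\<in>insert m I. v k))"
  proof -
    have V: "v m + (\<Sum>k\<in>I. v k) > 0"
      using v by (intro add_pos_nonneg sum_nonneg) (auto intro: less_imp_le)
    have "(\<integral>\<^sup>+w. ennreal ((\<Prod>k\<in>I. ?n k (w k)) * ?n m (0 - (\<Sum>k\<in>I. w k))) \<partial>?M) =
        ennreal (normal_density 0 (sqrt (v m + (\<Sum>k\<in>I. v k))) 0)"
      by (rule nn_integral_normal_density_convolution) (use I v in auto)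
    then have "(\<integral>w. (\<Prod>k\<in>I. ?n k (w k)) * ?n m (0 - (\<Sum>k\<in>I. w k)) \<partial>?M) =
        normal_density 0 (sqrt (v m + (\<Sum>k\<in>I. v k))) 0"
      by (subst integral_eq_nn_integral) (auto simp: prod_nonneg)
    then show ?thesis
      using V I by (simp add: normal_density_def)
  qed
  ultimately show ?thesis by simp
qed

text \<open>The normalised sum is the integral of a step function, to which dominated convergence applies.\<close>

lemma riemann_sum_tendsto:
  fixes Q :: "nat \<Rightarrow> real \<Rightarrow> real" and t C :: real
  assumes lim: "\<And>S s. S \<longlonglongrightarrow> s \<Longrightarrow> (\<lambda>N. Q N (S N)) \<longlonglongrightarrow> q s"
    and bound: "\<forall>\<^sub>F N in sequentially. \<forall>l<N. \<bar>Q N ((real l - t * N) / sqrt N)\<bar> \<le> C * exp (- \<bar>(real l - t * N) / sqrt N\<bar>)"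
    and q [measurable]: "q \<in> borel_measurable borel" and "C > 0"
  defines "A \<equiv> {s::real. (t > 0 \<or> t = 0 \<and> s \<ge> 0) \<and> (t < 1 \<or> t = 1 \<and> s < 0)}"
  shows "(\<lambda>N. (\<Sum>l<N. Q N ((real l - t * N) / sqrt N)) / sqrt N) \<longlonglongrightarrow> (\<integral>s. indicator A s * q s \<partial>lborel)"
proof -
  \<comment> \<open>\<open>p N\<close> rescales indices and \<open>y N\<close> is its inverse;
    \<open>F N\<close> is constant on each cell of width 1 / sqrt N, with the value of
    \<open>Q N\<close> at the left end point.\<close>
  define p where "p N l = (l - t * real N) / sqrt (real N)" for N :: nat and l :: real
  define F where "F N s = (\<Sum>l<N. Q N (p N l) * indicator {p N l..<p N (real l + 1)} s)" for N s
  define y where "y N s = s * sqrt (real N) + t * real N" for N :: nat and s :: real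
  have F_eq: "F N s = (if 0 \<le> y N s \<and> y N s < N then Q N (p N \<lfloor>y N s\<rfloor>) else 0)" if "N > 0" for N s
  proof -
    have mem: "s \<in> {p N l..<p N (real l + 1)} \<longleftrightarrow> \<lfloor>y N s\<rfloor> = int l" for l :: nat
    proof -
      have "s \<in> {p N l..<p N (real l + 1)} \<longleftrightarrow> real l \<le> y N s \<and> y N s < real l + 1"
        using that by (simp add: p_def y_def field_simps)
      also have "\<dots> \<longleftrightarrow> \<lfloor>y N s\<rfloor> = int l"
        by (simp add: floor_eq_iff)
      finally show ?thesis .
    qed
    have "F N s = (\<Sum>l<N. if int l = \<lfloor>y N s\<rfloor> then Q N (p N (real l)) else 0)"
      unfolding F_def by (intro sum.cong refl) (simp add: indicator_def mem eq_commute del: atLeastLessThan_iff)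
    also have "\<dots> = (if 0 \<le> y N s \<and> y N s < N then Q N (p N \<lfloor>y N s\<rfloor>) else 0)"
    proof (cases "0 \<le> y N s \<and> y N s < N")
      case True
      define l0 where "l0 = nat \<lfloor>y N s\<rfloor>"
      have l0: "\<lfloor>y N s\<rfloor> = int l0" "l0 < N"
        using True by (auto simp: l0_def) linarith
      show ?thesis
        using True l0 by (simp add: sum.delta)
    next
      case False
      have "int l \<noteq> \<lfloor>y N s\<rfloor>" if "l < N" for l
        using False that by linarith
      then have "(\<Sum>l<N. if int l = \<lfloor>y N s\<rfloor> then Q N (p N (real l)) else 0) = 0"
        by (intro sum.neutral) auto
      then show ?thesis by (simp only: False if_False)
    qed
    finally show ?thesis .
  qed
  have p_close: "\<bar>p N \<lfloor>y N s\<rfloor> - s\<bar> \<le> 1 / sqrt (real N)" if "N > 0" for N s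
  proof -
    have "p N f - s = (f - y N s) / sqrt (real N)" for f
      using that by (simp add: p_def y_def diff_divide_distrib add_divide_distrib)
    moreover have "\<bar>real_of_int \<lfloor>y N s\<rfloor> - y N s\<bar> \<le> 1" by linarith
    ultimately show ?thesis by (simp add: divide_right_mono)
  qed
  have inv: "(\<lambda>N. 1 / sqrt (real N)) \<longlonglongrightarrow> 0"
    by real_asymp
  have p_lim: "(\<lambda>N. p N \<lfloor>y N s\<rfloor>) \<longlonglongrightarrow> s" for s
    by (rule LIM_zero_cancel, rule Lim_null_comparison[OF _ inv])
      (auto intro!: eventually_mono[OF eventually_gt_at_top[of 0]] p_close)
  \<comment> \<open>A term c N with c > 0 dominates s sqrt N, so for t different from 0 and 1 the
    index range is eventually decided by t alone.\<close>
  have ev: "\<forall>\<^sub>F N in sequentially. 0 < s * sqrt (real N) + c * real N" if "c > 0" for s c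
    using that by real_asymp
  have F_lim: "(\<lambda>N. F N s) \<longlonglongrightarrow> indicator A s * q s" for s
  proof -
    \<comment> \<open>At t = 0, and at t = 1 for the upper end, the terms of order N cancel and the
      sign of s decides. The cells are half-open, so s = 0 is kept at t = 0 and dropped at t =
      1.\<close>
    have lower: "\<forall>\<^sub>F N in sequentially. 0 \<le> y N s \<longleftrightarrow> t > 0 \<or> t = 0 \<and> s \<ge> 0"
    proof -
      consider "t > 0" | "t = 0" | "t < 0" by linarith
      then show ?thesis
      proof cases
        case 1
        show ?thesis using ev[OF 1, of s] by eventually_elim (use 1 in \<open>simp add: y_def\<close>)
      next
        case 2
        then show ?thesis
          by (intro eventually_mono[OF eventually_gt_at_top[of 0]]) (simp add: y_def zero_le_mult_iff)
      next
        case 3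
        then have "- t > 0" by simp
        show ?thesis using ev[OF \<open>- t > 0\<close>, of "- s"] by eventually_elim (use 3 in \<open>simp add: y_def\<close>)
      qed
    qed
    have upper: "\<forall>\<^sub>F N in sequentially. y N s < N \<longleftrightarrow> t < 1 \<or> t = 1 \<and> s < 0"
    proof -
      consider "t < 1" | "t = 1" | "t > 1" by linarith
      then show ?thesis
      proof cases
        case 1
        then have "1 - t > 0" by simp
        show ?thesis using ev[OF \<open>1 - t > 0\<close>, of "- s"]
          by eventually_elim (use 1 in \<open>simp add: y_def algebra_simps\<close>)
      next
        case 2
        then show ?thesis
          by (intro eventually_mono[OF eventually_gt_at_top[of 0]]) (simp add: y_def mult_less_0_iff)
      next
        case 3
        then have "t - 1 > 0" by simp
        show ?thesis using ev[OF \<open>t - 1 > 0\<close>, of s]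
          by eventually_elim (use 3 in \<open>simp add: y_def algebra_simps\<close>)
      qed
    qed
    have "\<forall>\<^sub>F N in sequentially. indicator A s * Q N (p N \<lfloor>y N s\<rfloor>) = F N s"
      using lower upper eventually_gt_at_top[of 0]
      by eventually_elim (simp add: F_eq A_def indicator_def)
    moreover have "(\<lambda>N. indicator A s * Q N (p N \<lfloor>y N s\<rfloor>)) \<longlonglongrightarrow> indicator A s * q s"
      by (intro tendsto_mult tendsto_const lim p_lim)
    ultimately show ?thesis by (rule Lim_transform_eventually[rotated])
  qed
  have F_bound: "\<forall>\<^sub>F N in sequentially. \<forall>s\<in>space lborel. \<bar>F N s\<bar> \<le> C * exp 1 * exp (- \<bar>s\<bar>)"
    using bound eventually_gt_at_top[of 0]
  proof eventually_elim
    case (elim N)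
    show ?case
    proof
      fix s :: real
      show "\<bar>F N s\<bar> \<le> C * exp 1 * exp (- \<bar>s\<bar>)"
      proof (cases "0 \<le> y N s \<and> y N s < N")
        case False
        then have "F N s = 0" by (simp only: F_eq[OF elim(2)] if_False)
        then show ?thesis using \<open>C > 0\<close> by simp
      next
        case True
        define l where "l = nat \<lfloor>y N s\<rfloor>"
        have l: "\<lfloor>y N s\<rfloor> = int l" "l < N"
          using True by (auto simp: l_def) linarith
        have "1 / sqrt (real N) \<le> 1" using elim by simp
        then have "\<bar>s\<bar> - 1 \<le> \<bar>p N l\<bar>"
          using p_close[OF elim(2), of s] unfolding l(1) of_int_of_nat_eq by linarith
        have "\<bar>F N s\<bar> = \<bar>Q N (p N l)\<bar>"
          using True l elim by (simp add: F_eq)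
        also have "\<dots> \<le> C * exp (- \<bar>p N l\<bar>)"
          using elim(1) l by (simp add: p_def)
        \<comment> \<open>The lattice point is within 1 / sqrt N <= 1 of s; the factor exp 1 pays
          for replacing one by the other.\<close>
        also have "\<dots> \<le> C * exp (1 + - \<bar>s\<bar>)"
          using \<open>C > 0\<close> \<open>\<bar>s\<bar> - 1 \<le> \<bar>p N l\<bar>\<close> by (intro mult_left_mono) auto
        also have "\<dots> = C * exp 1 * exp (- \<bar>s\<bar>)"
          by (simp only: exp_add mult.assoc)
        finally show ?thesis .
      qed
    qed
  qed
  have "(\<lambda>N. \<integral>s. F N s \<partial>lborel) \<longlonglongrightarrow> (\<integral>s. indicator A s * q s \<partial>lborel)"
  proof (rule dominated_convergence_eventually(1)[OF _ _ _ F_lim F_bound])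
    show "F N \<in> borel_measurable lborel" for N
      unfolding F_def by measurable
    show "(\<lambda>s. indicator A s * q s) \<in> borel_measurable lborel"
      unfolding A_def by measurable
  qed (simp add: integrable_exp_neg_abs)
  moreover have "\<forall>\<^sub>F N in sequentially. (\<integral>s. F N s \<partial>lborel) = (\<Sum>l<N. Q N ((real l - t * N) / sqrt N)) / sqrt N"
  proof (rule eventually_mono[OF eventually_gt_at_top[of 0]])
    fix N :: nat assume N: "N > 0"
    have len: "p N l \<le> p N (l + 1)" "p N (l + 1) - p N l = 1 / sqrt N" for l
      using N by (auto simp: p_def field_simps)
    have "(\<integral>s. F N s \<partial>lborel) = (\<Sum>l<N. Q N (p N l) * (\<integral>s. indicator {p N l..<p N (real l + 1)} s \<partial>lborel))"
      unfolding F_def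
      by (subst Bochner_Integration.integral_sum)
        (auto simp: len intro!: integrable_mult_right integrable_real_indicator)
    also have "\<dots> = (\<Sum>l<N. Q N (p N l) / sqrt N)"
      by (intro sum.cong refl) (simp add: len measure_def)
    finally show "(\<integral>s. F N s \<partial>lborel) = (\<Sum>l<N. Q N ((real l - t * N) / sqrt N)) / sqrt N"
      by (simp add: p_def sum_divide_distrib)
  qed
  ultimately show ?thesis by (rule Lim_transform_eventually)
qed

section \<open>Gaussian integrals over half-lines and the joint limit\<close>

text \<open>This is \<open>annulus_chi\<close> read in the saddle coordinate: the outer circle is t
  = 1 and the inner circle, if there is one, is t = 0.\<close>

definition step_chi :: "real \<Rightarrow> real" where
  "step_chi t = (if 0 < t \<and> t < 1 then 1 else if t = 0 \<or> t = 1 then 1 / 2 else 0)"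

text \<open>The domain is the line, a half-line or empty. By evenness a half-line carries half of
  the integral, which is the origin of the value 1/2 on the boundary circles.\<close>

lemma integral_truncated_gaussian:
  assumes "V > 0"
  shows "(\<integral>s. indicator {s. (t > 0 \<or> t = 0 \<and> s \<ge> 0) \<and> (t < 1 \<or> t = 1 \<and> s < 0)} s * exp (- V * s\<^sup>2 / 2) \<partial>lborel) =
    step_chi t * sqrt (2 * pi / V)"
proof -
  define G where "G = (\<lambda>s. exp (- V * s\<^sup>2 / 2))"
  have G_eq: "G s = exp (- s\<^sup>2 / (2 * (1 / V))) * exp (0 * s)" for s
    using assms by (simp add: G_def field_simps)
  have total: "(\<integral>s. G s \<partial>lborel) = sqrt (2 * pi / V)"
    unfolding G_eq using assms by (subst integral_gaussian_mgf) auto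
  have int: "integrable lborel G"
    unfolding G_eq[abs_def] using assms by (subst gaussian_eq_normal_density) auto
  have int': "integrable lborel (\<lambda>s. indicator B s * G s)" if "B \<in> sets borel" for B
    using integrable_mult_indicator[OF _ int, of B] that by simp
  have refl: "(\<integral>s. indicator {0..} s * G s \<partial>lborel) = (\<integral>s. indicator {..<0} s * G s \<partial>lborel)"
  proof -
    have "(\<integral>s. indicator {0..} s * G s \<partial>lborel) = (\<integral>s. indicator {0..} (- s) * G (- s) \<partial>lborel)"
      using lborel_integral_real_affine[of "-1" "\<lambda>s. indicator {0..} s * G s" 0] by simp
    \<comment> \<open>Reflection produces the closed half-line, which differs from the open one by
      the null set {0}.\<close>
    also have "\<dots> = (\<integral>s. indicator {..<0} s * G s \<partial>lborel)"
      by (rule integral_cong_AE)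
        (auto intro!: AE_I[where N = "{0}"] simp: G_def indicator_def split: if_splits)
    finally show ?thesis .
  qed
  have "(\<integral>s. indicator {0..} s * G s \<partial>lborel) + (\<integral>s. indicator {..<0} s * G s \<partial>lborel) =
      (\<integral>s. indicator {0..} s * G s + indicator {..<0} s * G s \<partial>lborel)"
    by (intro Bochner_Integration.integral_add[symmetric] int') auto
  also have "\<dots> = (\<integral>s. G s \<partial>lborel)"
    by (intro Bochner_Integration.integral_cong) (auto simp: indicator_def)
  finally have half: "(\<integral>s. indicator {0..} s * G s \<partial>lborel) = sqrt (2 * pi / V) / 2"
    "(\<integral>s. indicator {..<0} s * G s \<partial>lborel) = sqrt (2 * pi / V) / 2"
    using refl total by auto
  consider "t < 0 \<or> t > 1" | "t = 0" | "t = 1" | "0 < t" "t < 1" by linarith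
  then have "(\<integral>s. indicator {s. (t > 0 \<or> t = 0 \<and> s \<ge> 0) \<and> (t < 1 \<or> t = 1 \<and> s < 0)} s * G s \<partial>lborel) =
    step_chi t * sqrt (2 * pi / V)"
  proof cases
    case 1
    then show ?thesis by (auto simp: step_chi_def)
  next
    case 2
    then show ?thesis using half(1) by (simp add: step_chi_def atLeast_def)
  next
    case 3
    then show ?thesis using half(2) by (simp add: step_chi_def lessThan_def)
  next
    case 4
    then show ?thesis using total by (simp add: step_chi_def)
  qed
  then show ?thesis by (simp add: G_def)
qed

text \<open>The factors sqrt (2 pi v k) of the convolution cancel those of the generating functions,
  and sqrt (2 pi / V) / sqrt (2 pi V) = 1 / V remains. The eventual hypothesis makes the first Beta
  parameter positive for every l >= 0, so that all generating functions in the sum converge.\<close>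

lemma bump_conv_sum_tendsto:
  fixes \<alpha> \<tau> \<beta> :: "'i \<Rightarrow> real" and t :: real
  assumes I: "finite I" "m \<notin> I" and pos: "\<And>k. k \<in> insert m I \<Longrightarrow> \<alpha> k > 0" "\<And>k. k \<in> insert m I \<Longrightarrow> \<tau> k > 0"
    and ev: "\<forall>\<^sub>F N in sequentially. \<forall>k\<in>insert m I. (\<alpha> k - t) * real N + \<beta> k > 0"
  shows "(\<lambda>N. bump_conv \<alpha> \<tau> \<beta> I m (sqrt N) *
      (\<Sum>l<N. \<Prod>k\<in>insert m I. 1 / bump_mgf (\<alpha> k) (\<tau> k) (\<beta> k) (sqrt N) ((real l - t * N) / sqrt N)) / sqrt N)
    \<longlonglongrightarrow> step_chi t / (\<Sum>k\<in>insert m I. bump_var (\<alpha> k) (\<tau> k))"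
proof -
  define K where "K = insert m I"
  define v where "v k = bump_var (\<alpha> k) (\<tau> k)" for k
  define V where "V = (\<Sum>k\<in>K. v k)"
  define P where "P N k = bump_mgf (\<alpha> k) (\<tau> k) (\<beta> k) (sqrt (real N))" for N k
  have K: "finite K" "K \<noteq> {}" using I by (auto simp: K_def)
  have v: "v k > 0" if "k \<in> K" for k
    using that pos by (simp add: v_def K_def bump_var_pos)
  have V: "V > 0" unfolding V_def using K v by (intro sum_pos) auto
  have X: "filterlim (\<lambda>N. sqrt (real N)) at_top sequentially" by real_asymp
  have "\<forall>k\<in>K. \<exists>c. c > 0 \<and> (\<forall>\<^sub>F N in sequentially. \<forall>s.
    integrable lborel (\<lambda>w. bump (\<alpha> k) (\<tau> k) (\<beta> k) (sqrt (real N)) w * exp (s * w)) \<longrightarrow>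
    c * exp \<bar>s\<bar> \<le> P N k s)"
  proof
    fix k assume "k \<in> K"
    then have k: "\<alpha> k > 0" "\<tau> k > 0" using pos by (auto simp: K_def)
    from bump_mgf_lower_bound[OF k X, of "\<beta> k"] obtain c where "c > 0"
      "\<forall>\<^sub>F N in sequentially. \<forall>s.
        integrable lborel (\<lambda>w. bump (\<alpha> k) (\<tau> k) (\<beta> k) (sqrt (real N)) w * exp (s * w)) \<longrightarrow>
        c * exp \<bar>s\<bar> \<le> bump_mgf (\<alpha> k) (\<tau> k) (\<beta> k) (sqrt (real N)) s"
      by this
    then show "\<exists>c. c > 0 \<and> (\<forall>\<^sub>F N in sequentially. \<forall>s.
        integrable lborel (\<lambda>w. bump (\<alpha> k) (\<tau> k) (\<beta> k) (sqrt (real N)) w * exp (s * w)) \<longrightarrow>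
        c * exp \<bar>s\<bar> \<le> P N k s)"
      unfolding P_def by (intro exI conjI)
  qed
  from bchoice[OF this] obtain c where c': "\<forall>k\<in>K. c k > 0 \<and> (\<forall>\<^sub>F N in sequentially. \<forall>s.
    integrable lborel (\<lambda>w. bump (\<alpha> k) (\<tau> k) (\<beta> k) (sqrt (real N)) w * exp (s * w)) \<longrightarrow>
    c k * exp \<bar>s\<bar> \<le> P N k s)" ..
  have c: "\<And>k. k \<in> K \<Longrightarrow> c k > 0" "\<And>k. k \<in> K \<Longrightarrow> \<forall>\<^sub>F N in sequentially. \<forall>s.
    integrable lborel (\<lambda>w. bump (\<alpha> k) (\<tau> k) (\<beta> k) (sqrt (real N)) w * exp (s * w)) \<longrightarrow>
    c k * exp \<bar>s\<bar> \<le> P N k s"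
    using c' by simp_all
  have "\<forall>\<^sub>F N in sequentially. \<forall>k\<in>K. \<forall>s.
    integrable lborel (\<lambda>w. bump (\<alpha> k) (\<tau> k) (\<beta> k) (sqrt (real N)) w * exp (s * w)) \<longrightarrow>
    c k * exp \<bar>s\<bar> \<le> P N k s"
    by (intro eventually_ball_finite ballI K(1) c(2))
  then have bound: "\<forall>\<^sub>F N in sequentially. \<forall>l<N. \<bar>\<Prod>k\<in>K. 1 / P N k ((real l - t * N) / sqrt N)\<bar> \<le>
      (\<Prod>k\<in>K. 1 / c k) * exp (- \<bar>(real l - t * N) / sqrt N\<bar>)"
    using ev eventually_gt_at_top[of 0]
  proof eventually_elim
    case (elim N)
    show ?case
    proof (intro allI impI)
      fix l assume "l < N"
      define s where "s = (real l - t * N) / sqrt N"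
      have P: "c k * exp \<bar>s\<bar> \<le> P N k s" if k: "k \<in> K" for k
      proof -
        have "s * sqrt (real N) = real l - t * real N"
          using elim(3) by (simp add: s_def)
        then have "\<alpha> k * (sqrt (real N))\<^sup>2 + \<beta> k + s * sqrt (real N) = ((\<alpha> k - t) * real N + \<beta> k) + real l"
          by (simp add: left_diff_distrib)
        moreover have "((\<alpha> k - t) * real N + \<beta> k) + real l > 0"
          using bspec[OF elim(2), of k] k by (simp add: K_def add_pos_nonneg)
        ultimately have "integrable lborel (\<lambda>w. bump (\<alpha> k) (\<tau> k) (\<beta> k) (sqrt (real N)) w * exp (s * w))"
          using pos k elim(3) by (intro integrable_bump_mgf) (auto simp: K_def)
        then show ?thesis using elim(1) k by blast
      qed
      have Ppos: "P N k s > 0" if "k \<in> K" for k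
        using P[OF that] c(1)[OF that] by (auto intro: less_le_trans[rotated])
      have "(\<Prod>k\<in>K. 1 / P N k s) \<le> (\<Prod>k\<in>K. 1 / (c k * exp \<bar>s\<bar>))"
        using P c(1) Ppos by (intro prod_mono conjI divide_left_mono) (auto intro: less_imp_le)
      also have "\<dots> = (\<Prod>k\<in>K. 1 / c k) * exp (- \<bar>s\<bar>) ^ card K"
        by (simp add: prod.distrib divide_inverse exp_minus)
      \<comment> \<open>One factor exp (-|s|) suffices as majorant; \<open>K\<close> contains
        \<open>m\<close>, so there is at least one.\<close>
      also have "\<dots> \<le> (\<Prod>k\<in>K. 1 / c k) * exp (- \<bar>s\<bar>) ^ 1"
        using K c(1) by (intro mult_left_mono power_decreasing prod_nonneg)
          (auto simp: Suc_le_eq card_gt_0_iff intro: less_imp_le)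
      finally have "(\<Prod>k\<in>K. 1 / P N k s) \<le> (\<Prod>k\<in>K. 1 / c k) * exp (- \<bar>s\<bar>)" by simp
      moreover have "(\<Prod>k\<in>K. 1 / P N k s) \<ge> 0"
        using Ppos by (intro prod_nonneg) (auto intro: less_imp_le)
      ultimately show "\<bar>\<Prod>k\<in>K. 1 / P N k ((real l - t * N) / sqrt N)\<bar> \<le>
          (\<Prod>k\<in>K. 1 / c k) * exp (- \<bar>(real l - t * N) / sqrt N\<bar>)"
        unfolding s_def[symmetric] by (simp only: abs_of_nonneg)
    qed
  qed
  have "(\<lambda>N. (\<Sum>l<N. (\<lambda>s. \<Prod>k\<in>K. 1 / P N k s) ((real l - t * N) / sqrt N)) / sqrt N) \<longlonglongrightarrow>
      (\<integral>s. indicator {s::real. (t > 0 \<or> t = 0 \<and> s \<ge> 0) \<and> (t < 1 \<or> t = 1 \<and> s < 0)} s *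
        (\<Prod>k\<in>K. 1 / (sqrt (2 * pi * v k) * exp (v k * s\<^sup>2 / 2))) \<partial>lborel)"
  proof (rule riemann_sum_tendsto[OF _ bound])
    fix S :: "nat \<Rightarrow> real" and s assume S: "S \<longlonglongrightarrow> s"
    show "(\<lambda>N. \<Prod>k\<in>K. 1 / P N k (S N)) \<longlonglongrightarrow> (\<Prod>k\<in>K. 1 / (sqrt (2 * pi * v k) * exp (v k * s\<^sup>2 / 2)))"
    proof (intro tendsto_prod tendsto_divide tendsto_const)
      fix k assume k: "k \<in> K"
      show "(\<lambda>N. P N k (S N)) \<longlonglongrightarrow> sqrt (2 * pi * v k) * exp (v k * s\<^sup>2 / 2)"
        unfolding P_def v_def using k pos by (intro bump_mgf_tendsto X S) (auto simp: K_def)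
      show "sqrt (2 * pi * v k) * exp (v k * s\<^sup>2 / 2) \<noteq> 0"
        using v[OF k] by simp
    qed
  qed (use c(1) in \<open>auto intro!: prod_pos\<close>)
  also have "(\<lambda>s::real. \<Prod>k\<in>K. 1 / (sqrt (2 * pi * v k) * exp (v k * s\<^sup>2 / 2))) =
      (\<lambda>s. exp (- V * s\<^sup>2 / 2) / (\<Prod>k\<in>K. sqrt (2 * pi * v k)))"
  proof
    fix s :: real
    have "(\<Prod>k\<in>K. exp (v k * s\<^sup>2 / 2)) = exp (V * s\<^sup>2 / 2)"
      using K by (simp add: V_def exp_sum[symmetric] sum_distrib_right sum_divide_distrib)
    then show "(\<Prod>k\<in>K. 1 / (sqrt (2 * pi * v k) * exp (v k * s\<^sup>2 / 2))) =
        exp (- V * s\<^sup>2 / 2) / (\<Prod>k\<in>K. sqrt (2 * pi * v k))"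
      by (simp add: prod_dividef prod.distrib exp_minus field_simps)
  qed
  finally have sum_lim: "(\<lambda>N. (\<Sum>l<N. \<Prod>k\<in>K. 1 / P N k ((real l - t * N) / sqrt N)) / sqrt N) \<longlonglongrightarrow>
      step_chi t * sqrt (2 * pi / V) / (\<Prod>k\<in>K. sqrt (2 * pi * v k))"
    using integral_truncated_gaussian[OF V, of t] by simp
  have "(\<lambda>N. bump_conv \<alpha> \<tau> \<beta> I m (sqrt N)) \<longlonglongrightarrow> (\<Prod>k\<in>K. sqrt (2 * pi * v k)) / sqrt (2 * pi * V)"
    unfolding v_def V_def K_def by (rule bump_conv_tendsto[OF I pos X])
  from tendsto_mult[OF this sum_lim]
  have "(\<lambda>N. bump_conv \<alpha> \<tau> \<beta> I m (sqrt N) *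
      ((\<Sum>l<N. \<Prod>k\<in>K. 1 / P N k ((real l - t * N) / sqrt N)) / sqrt N)) \<longlonglongrightarrow>
    (\<Prod>k\<in>K. sqrt (2 * pi * v k)) / sqrt (2 * pi * V) *
      (step_chi t * sqrt (2 * pi / V) / (\<Prod>k\<in>K. sqrt (2 * pi * v k)))" .
  also have "(\<Prod>k\<in>K. sqrt (2 * pi * v k)) / sqrt (2 * pi * V) *
      (step_chi t * sqrt (2 * pi / V) / (\<Prod>k\<in>K. sqrt (2 * pi * v k))) = step_chi t / V"
  proof -
    have "(\<Prod>k\<in>K. sqrt (2 * pi * v k)) > 0"
      using v by (intro prod_pos) auto
    moreover have "sqrt (2 * pi / V) / sqrt (2 * pi * V) = 1 / V"
      using V by (simp add: real_sqrt_divide real_sqrt_mult)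
    moreover have "p / a * (e * b / p) = e / V" if "p > 0" "b / a = 1 / V" for p a b e :: real
    proof -
      have "p / a * (e * b / p) = e * (b / a)" using that(1) by simp
      then show ?thesis by (simp add: that(2))
    qed
    ultimately show ?thesis by blast
  qed
  finally show ?thesis by (simp add: P_def v_def V_def K_def)
qed

section \<open>The saddle point\<close>

text \<open>Intermediate values: the product is 0 at t = -min \<sigma>_k, where one numerator
  vanishes, and tends to 1 at infinity. To the right of -min \<sigma>_k all numerators are
  positive.\<close>

lemma saddle_point_exists:
  fixes \<sigma> \<tau> :: "nat \<Rightarrow> real"
  assumes "m \<ge> 1" and \<tau>: "\<And>k. k \<in> {1..m} \<Longrightarrow> \<tau> k > 0" and x: "0 < x" "x < 1"
  obtains t where "\<And>k. k \<in> {1..m} \<Longrightarrow> \<sigma> k + t > 0"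
    and "(\<Prod>k\<in>{1..m}. (\<sigma> k + t) / (\<sigma> k + t + \<tau> k)) = x"
proof -
  define s0 where "s0 = Min (\<sigma> ` {1..m})"
  have fin: "finite (\<sigma> ` {1..m})" "\<sigma> ` {1..m} \<noteq> {}" using assms(1) by auto
  have s0: "s0 \<le> \<sigma> k" if "k \<in> {1..m}" for k
    unfolding s0_def using fin that by (intro Min_le) auto
  obtain j where j: "j \<in> {1..m}" "s0 = \<sigma> j"
    using Min_in[OF fin] by (auto simp: s0_def)
  define f where "f t = (\<Prod>k\<in>{1..m}. (\<sigma> k + t) / (\<sigma> k + t + \<tau> k))" for t
  have "f (- s0) = 0"
    unfolding f_def using j by (intro prod_zero) auto
  have "(f \<longlongrightarrow> (\<Prod>k\<in>{1..m}. 1)) at_top"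
    unfolding f_def
  proof (rule tendsto_prod)
    fix k
    show "((\<lambda>t. (\<sigma> k + t) / (\<sigma> k + t + \<tau> k)) \<longlongrightarrow> 1) at_top" by real_asymp
  qed
  then have "(f \<longlongrightarrow> 1) at_top" by simp
  from order_tendstoD(1)[OF this x(2)] eventually_ge_at_top[of "- s0"]
  have "\<forall>\<^sub>F t in at_top. x < f t \<and> - s0 \<le> t"
    by (rule eventually_conj)
  then obtain T where T: "x < f T" "- s0 \<le> T"
    using eventually_happens'[OF trivial_limit_at_top_linorder] by blast
  have cont: "continuous_on {- s0..T} f"
    unfolding f_def
  proof (intro continuous_intros ballI)
    fix k t assume "k \<in> {1..m}" "t \<in> {- s0..T}"
    then show "\<sigma> k + t + \<tau> k \<noteq> 0"
      using s0[of k] \<tau>[of k] by auto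
  qed
  obtain t where t: "- s0 \<le> t" "t \<le> T" "f t = x"
    using IVT'[of f "- s0" x T] T x \<open>f (- s0) = 0\<close> cont by auto
  have "t \<noteq> - s0" using t \<open>f (- s0) = 0\<close> x by auto
  then have "\<sigma> k + t > 0" if "k \<in> {1..m}" for k
    using s0[OF that] t by auto
  then show ?thesis using t(3) by (intro that) (auto simp: f_def)
qed

lemma prod_ratio_strict_mono:
  fixes \<sigma> \<tau> :: "nat \<Rightarrow> real"
  assumes "m \<ge> 1" and \<tau>: "\<And>k. k \<in> {1..m} \<Longrightarrow> \<tau> k > 0"
    and s: "\<And>k. k \<in> {1..m} \<Longrightarrow> \<sigma> k + s \<ge> 0" and "s < t"
  shows "(\<Prod>k\<in>{1..m}. (\<sigma> k + s) / (\<sigma> k + s + \<tau> k)) < (\<Prod>k\<in>{1..m}. (\<sigma> k + t) / (\<sigma> k + t + \<tau> k))"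
proof -
  have less: "(\<sigma> k + s) / (\<sigma> k + s + \<tau> k) < (\<sigma> k + t) / (\<sigma> k + t + \<tau> k)" if k: "k \<in> {1..m}" for k
  proof -
    have "(\<sigma> k + s) * (\<sigma> k + t + \<tau> k) < (\<sigma> k + t) * (\<sigma> k + s + \<tau> k)"
      using mult_strict_right_mono[OF \<open>s < t\<close> \<tau>[OF k]] by (simp add: algebra_simps)
    moreover have "\<sigma> k + s + \<tau> k > 0" "\<sigma> k + t + \<tau> k > 0"
      using s[OF k] \<tau>[OF k] \<open>s < t\<close> by linarith+
    ultimately show ?thesis
      by (simp add: pos_divide_less_eq pos_less_divide_eq)
  qed
  have nonneg: "0 \<le> (\<sigma> k + s) / (\<sigma> k + s + \<tau> k)" if k: "k \<in> {1..m}" for k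
    using s[OF k] \<tau>[OF k] by simp
  show ?thesis
  proof (rule prod_mono_strict)
    show "m \<in> {1..m}" using assms(1) by simp
    then show "(\<sigma> m + s) / (\<sigma> m + s + \<tau> m) < (\<sigma> m + t) / (\<sigma> m + t + \<tau> m)"
      by (rule less)
    fix k assume k: "k \<in> {1..m}"
    show "0 \<le> (\<sigma> k + s) / (\<sigma> k + s + \<tau> k) \<and>
        (\<sigma> k + s) / (\<sigma> k + s + \<tau> k) \<le> (\<sigma> k + t) / (\<sigma> k + t + \<tau> k)"
      using less[OF k] nonneg[OF k] by simp
    show "0 < (\<sigma> k + t) / (\<sigma> k + t + \<tau> k)"
      using less[OF k] nonneg[OF k] by linarith
  qed simp
qed

text \<open>Under t = y |z|^2 - \<sigma> m the polynomial equation is the saddle point equation with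
  denominators cleared. A larger root would also keep all \<sigma> k + t positive and thus
  contradict strict monotonicity; roots where some \<sigma> k + t is not positive are
  smaller.\<close>

lemma zeta_eq_saddle_point:
  assumes "m \<ge> 1" and \<tau>: "\<And>k. k \<in> {1..m} \<Longrightarrow> \<tau> k > 0" and "z \<noteq> 0"
    and t: "\<And>k. k \<in> {1..m} \<Longrightarrow> \<sigma> k + t > 0"
    and prod: "(\<Prod>k\<in>{1..m}. (\<sigma> k + t) / (\<sigma> k + t + \<tau> k)) = (cmod z)\<^sup>2"
  shows "(cmod z)\<^sup>2 * zeta m \<sigma> \<tau> z = \<sigma> m + t"
proof -
  define x where "x = (cmod z)\<^sup>2"
  have x: "x > 0" using \<open>z \<noteq> 0\<close> by (simp add: x_def)
  have ratio_eq: "Q / P = x \<longleftrightarrow> x * P - Q = 0" if "P > 0" for P Q :: real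
    using that by (auto simp: divide_eq_eq)
  have root: "x * (\<Prod>k\<in>{1..m}. \<sigma> k - \<sigma> m + \<tau> k + y * x) - (\<Prod>k\<in>{1..m}. \<sigma> k - \<sigma> m + y * x) = 0 \<longleftrightarrow>
      (\<Prod>k\<in>{1..m}. (\<sigma> k + (y * x - \<sigma> m)) / (\<sigma> k + (y * x - \<sigma> m) + \<tau> k)) = x"
    if "\<And>k. k \<in> {1..m} \<Longrightarrow> \<sigma> k + (y * x - \<sigma> m) > 0" for y
  proof -
    have "(\<Prod>k\<in>{1..m}. \<sigma> k + (y * x - \<sigma> m) + \<tau> k) > 0"
    proof (rule prod_pos)
      fix k assume k: "k \<in> {1..m}"
      show "\<sigma> k + (y * x - \<sigma> m) + \<tau> k > 0" by (rule add_pos_pos[OF that[OF k] \<tau>[OF k]])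
    qed
    moreover have e: "\<sigma> k - \<sigma> m + \<tau> k + y * x = \<sigma> k + (y * x - \<sigma> m) + \<tau> k"
      "\<sigma> k - \<sigma> m + y * x = \<sigma> k + (y * x - \<sigma> m)" for k
      by simp_all
    ultimately show ?thesis
      unfolding prod_dividef e by (intro ratio_eq[symmetric])
  qed
  have "zeta m \<sigma> \<tau> z = (\<sigma> m + t) / x"
    unfolding zeta_def x_def[symmetric]
  proof (rule Greatest_equality)
    have *: "(\<sigma> m + t) / x * x - \<sigma> m = t" using x by simp
    show "x * (\<Prod>k\<in>{1..m}. \<sigma> k - \<sigma> m + \<tau> k + (\<sigma> m + t) / x * x) - (\<Prod>k\<in>{1..m}. \<sigma> k - \<sigma> m + (\<sigma> m + t) / x * x) = 0"
      by (subst root) (use t prod in \<open>simp_all only: * x_def[symmetric]\<close>)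
    fix y assume y: "x * (\<Prod>k\<in>{1..m}. \<sigma> k - \<sigma> m + \<tau> k + y * x) - (\<Prod>k\<in>{1..m}. \<sigma> k - \<sigma> m + y * x) = 0"
    show "y \<le> (\<sigma> m + t) / x"
    proof (rule ccontr)
      assume "\<not> ?thesis"
      then have less: "t < y * x - \<sigma> m" using x by (simp add: field_simps)
      have "\<sigma> k + (y * x - \<sigma> m) > 0" if "k \<in> {1..m}" for k
        using t[OF that] less by linarith
      with y have "(\<Prod>k\<in>{1..m}. (\<sigma> k + (y * x - \<sigma> m)) / (\<sigma> k + (y * x - \<sigma> m) + \<tau> k)) = x"
        using root by blast
      moreover have "(\<Prod>k\<in>{1..m}. (\<sigma> k + t) / (\<sigma> k + t + \<tau> k)) <
          (\<Prod>k\<in>{1..m}. (\<sigma> k + (y * x - \<sigma> m)) / (\<sigma> k + (y * x - \<sigma> m) + \<tau> k))"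
        by (rule prod_ratio_strict_mono) (use assms(1) \<tau> t less in \<open>auto intro: less_imp_le\<close>)
      ultimately show False using prod by (simp add: x_def)
    qed
  qed
  then show ?thesis using x by (simp add: x_def)
qed

text \<open>The squares of the inner radius, of |z| and of the outer radius are the values of one
  strictly increasing function \<open>f\<close> at 0, t and 1.\<close>

lemma annulus_chi_eq_step_chi:
  assumes "m \<ge> 1" and \<sigma>: "\<And>k. k \<in> {1..m} \<Longrightarrow> \<sigma> k \<ge> 0" and \<tau>: "\<And>k. k \<in> {1..m} \<Longrightarrow> \<tau> k > 0"
    and t: "\<And>k. k \<in> {1..m} \<Longrightarrow> \<sigma> k + t > 0"
    and prod: "(\<Prod>k\<in>{1..m}. (\<sigma> k + t) / (\<sigma> k + t + \<tau> k)) = (cmod z)\<^sup>2"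
  shows "annulus_chi (r_in m \<sigma> \<tau>) (r_out m \<sigma> \<tau>) z = step_chi t"
proof -
  define f where "f s = (\<Prod>k\<in>{1..m}. (\<sigma> k + s) / (\<sigma> k + s + \<tau> k))" for s
  have mono: "f s < f s'" if "s < s'" "\<And>k. k \<in> {1..m} \<Longrightarrow> \<sigma> k + s \<ge> 0" for s s'
    unfolding f_def by (rule prod_ratio_strict_mono) (use assms(1) \<tau> that in auto)
  have ft: "f t = (cmod z)\<^sup>2" using prod by (simp add: f_def)
  have nn: "\<sigma> k + t \<ge> 0" if "k \<in> {1..m}" for k using t[OF that] by simp
  have r_in: "r_in m \<sigma> \<tau> = sqrt (f 0)"
    by (simp add: r_in_def f_def prod_dividef)
  have r_out: "r_out m \<sigma> \<tau> = sqrt (f 1)"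
    by (simp add: r_out_def f_def prod_dividef add.commute add.left_commute)
  have cmod: "cmod z = sqrt (f t)" by (simp add: ft)
  have "t > 0 \<Longrightarrow> f 0 < f t" "t < 0 \<Longrightarrow> f t < f 0" "t < 1 \<Longrightarrow> f t < f 1" "t > 1 \<Longrightarrow> f 1 < f t"
    by (rule mono; use \<sigma> nn in simp)+
  then have in_iff: "f 0 < f t \<longleftrightarrow> 0 < t" "f 0 = f t \<longleftrightarrow> t = 0"
    and out_iff: "f t < f 1 \<longleftrightarrow> t < 1" "f t = f 1 \<longleftrightarrow> t = 1"
    by (cases t "0::real" rule: linorder_cases; cases t "1::real" rule: linorder_cases; simp)+
  show ?thesis
  proof (cases "f 0 > 0")
    case True
    then show ?thesis
      unfolding annulus_chi_def r_in r_out cmod step_chi_def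
      using in_iff out_iff by auto
  next
    \<comment> \<open>Here the inner radius is 0. Since f t > 0, the saddle point is automatically
      positive, in agreement with the convention that there is no inner circle.\<close>
    case False
    have "f t > 0"
      unfolding f_def
    proof (rule prod_pos)
      fix k assume k: "k \<in> {1..m}"
      show "(\<sigma> k + t) / (\<sigma> k + t + \<tau> k) > 0"
        by (intro divide_pos_pos add_pos_pos[of "\<sigma> k + t"] t[OF k] \<tau>[OF k])
    qed
    with False have "f 0 < f t" by simp
    then have "t > 0" using in_iff by simp
    then show ?thesis
      unfolding annulus_chi_def r_in r_out cmod step_chi_def
      using False out_iff by auto
  qed
qed

section \<open>The one-point function as a convolution times a sum\<close>

text \<open>In the coordinates r_k = exp (\<theta>_k / 2), with \<theta>_k = ln \<rho>_k + w_k /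
  sqrt N, the m-th logarithm in the phase has the same form as the others once \<theta>_m is defined
  by the total being ln |z|^2. This gives m profiles in m - 1 variables; dr_k = h r_k dw_k accounts
  for \<open>h\<close>.\<close>

lemma weight_integrand_substitution:
  fixes \<sigma> \<tau> b :: "nat \<Rightarrow> real" and w :: "nat \<Rightarrow> real"
  assumes m: "m \<ge> 1" and N: "N > 0" and z: "z \<noteq> 0"
    and \<tau>: "\<And>k. k \<in> {1..m} \<Longrightarrow> \<tau> k > 0" and t: "\<And>k. k \<in> {1..m} \<Longrightarrow> \<sigma> k + t > 0"
    and prod: "(\<Prod>k\<in>{1..m}. (\<sigma> k + t) / (\<sigma> k + t + \<tau> k)) = (cmod z)\<^sup>2"
  defines "\<rho> \<equiv> \<lambda>k. (\<sigma> k + t) / (\<sigma> k + t + \<tau> k)" and "A \<equiv> \<lambda>k. \<sigma> k * real N + b k + 1"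
    and "h \<equiv> 1 / (2 * sqrt (real N))"
  defines "r \<equiv> \<lambda>k\<in>{1..<m}. exp (ln (\<rho> k) / 2 + h * w k)"
  shows "weight_integrand m \<sigma> \<tau> b N z r * (\<Prod>k\<in>{1..<m}. h * exp (ln (\<rho> k) / 2 + h * w k)) =
    ((cmod z)\<^sup>2) powr (- A m) * (\<Prod>k\<in>{1..m}. \<rho> k powr A k * (1 - \<rho> k) powr (\<tau> k * real N)) * h ^ (m - 1) *
    ((\<Prod>k\<in>{1..<m}. bump (\<sigma> k + t) (\<tau> k) (b k + 1) (sqrt (real N)) (w k)) *
      bump (\<sigma> m + t) (\<tau> m) (b m + 1) (sqrt (real N)) (- (\<Sum>k\<in>{1..<m}. w k)))"
proof -
  define I where "I = {1..<m}"
  have I: "finite I" "m \<notin> I" "{1..m} = insert m I" using m by (auto simp: I_def)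
  \<comment> \<open>Setting the m-th deviation to minus the sum of the others encodes the constraint
    on the product of the Beta variables.\<close>
  define u where "u k = (if k = m then - (\<Sum>k\<in>I. w k) else w k)" for k
  have u_I: "u k = w k" if "k \<in> I" for k using that by (auto simp: u_def I_def)
  have u_sum: "(\<Sum>k\<in>{1..m}. u k) = 0"
  proof -
    have "(\<Sum>k\<in>I. u k) = (\<Sum>k\<in>I. w k)" by (intro sum.cong refl u_I)
    then show ?thesis using I(1,2) unfolding I(3) by (simp add: u_def)
  qed
  define x where "x = (cmod z)\<^sup>2"
  have x: "x > 0" using z by (simp add: x_def)
  have \<rho>: "0 < \<rho> k" "\<rho> k < 1" if "k \<in> {1..m}" for k
    using \<tau>[OF that] t[OF that] by (auto simp: \<rho>_def)
  have \<rho>_prod: "(\<Prod>k\<in>{1..m}. \<rho> k) = x" using prod by (simp add: \<rho>_def x_def)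
  define \<theta> where "\<theta> k = ln (\<rho> k) + u k / sqrt (real N)" for k
  define L where "L k = ln (1 - exp (\<theta> k))" for k
  have ln_x: "(\<Sum>k\<in>{1..m}. ln (\<rho> k)) = ln x"
    unfolding \<rho>_prod[symmetric] using \<rho> by (subst ln_prod) (auto simp: less_imp_neq[THEN not_sym])
  have \<theta>_sum: "(\<Sum>k\<in>{1..m}. \<theta> k) = ln x"
    using u_sum ln_x by (simp add: \<theta>_def sum.distrib sum_divide_distrib[symmetric])
  have r: "r k = exp (\<theta> k / 2)" "r k > 0" "(r k)\<^sup>2 = exp (\<theta> k)" if "k \<in> I" for k
  proof -
    show "r k = exp (\<theta> k / 2)"
      using that N by (simp add: r_def I_def \<theta>_def u_I h_def field_simps)
    then show "r k > 0" "(r k)\<^sup>2 = exp (\<theta> k)"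
      by (simp_all add: exp_double[symmetric])
  qed
  have last: "(cmod z)\<^sup>2 / (\<Prod>k\<in>I. (r k)\<^sup>2) = exp (\<theta> m)"
  proof -
    have "(\<Prod>k\<in>I. (r k)\<^sup>2) = exp (\<Sum>k\<in>I. \<theta> k)"
      using I(1) by (simp add: r(3) exp_sum)
    moreover have "ln x = \<theta> m + (\<Sum>k\<in>I. \<theta> k)"
      using \<theta>_sum I(1,2) unfolding I(3) by simp
    then have "x = exp (\<theta> m + (\<Sum>k\<in>I. \<theta> k))"
      using x by (metis exp_ln)
    ultimately show ?thesis unfolding x_def[symmetric] by (simp add: exp_add)
  qed
  let ?b = "\<lambda>k. bump (\<sigma> k + t) (\<tau> k) (b k + 1) (sqrt (real N)) (u k)"
  have bump_cond: "(\<sigma> k + t) * exp (u k / sqrt (real N)) < \<sigma> k + t + \<tau> k \<longleftrightarrow> exp (\<theta> k) < 1" if "k \<in> {1..m}" for k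
  proof -
    have "exp (\<theta> k) = (\<sigma> k + t) * exp (u k / sqrt (real N)) / (\<sigma> k + t + \<tau> k)"
      using \<rho>[OF that] by (simp add: \<theta>_def exp_add) (simp add: \<rho>_def)
    then show ?thesis using \<tau>[OF that] t[OF that] by (simp add: divide_less_eq_1)
  qed
  have bumps: "(\<Prod>k\<in>I. bump (\<sigma> k + t) (\<tau> k) (b k + 1) (sqrt (real N)) (w k)) *
      bump (\<sigma> m + t) (\<tau> m) (b m + 1) (sqrt (real N)) (- (\<Sum>k\<in>I. w k)) = (\<Prod>k\<in>{1..m}. ?b k)"
  proof -
    have "(\<Prod>k\<in>I. ?b k) = (\<Prod>k\<in>I. bump (\<sigma> k + t) (\<tau> k) (b k + 1) (sqrt (real N)) (w k))"
      by (intro prod.cong refl) (simp add: u_I)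
    then show ?thesis
      using I(1,2) unfolding I(3) by (simp add: u_def mult.commute)
  qed
  have cond: "(\<forall>k\<in>I. r k > 0 \<and> 1 - (r k)\<^sup>2 > 0) \<and> 1 - (cmod z)\<^sup>2 / (\<Prod>k\<in>I. (r k)\<^sup>2) > 0 \<longleftrightarrow>
      (\<forall>k\<in>{1..m}. exp (\<theta> k) < 1)"
    unfolding last I(3) using r by auto
  show ?thesis
  proof (cases "\<forall>k\<in>{1..m}. exp (\<theta> k) < 1")
    case False
    then obtain j where "j \<in> {1..m}" "\<not> exp (\<theta> j) < 1" by blast
    then have "(\<Prod>k\<in>{1..m}. ?b k) = 0"
      using bump_cond[of j] by (intro prod_zero) (auto simp: bump_def intro!: bexI[of _ j])
    moreover have "weight_integrand m \<sigma> \<tau> b N z r = 0"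
      unfolding weight_integrand_def I_def[symmetric] using cond False by auto
    ultimately show ?thesis unfolding I_def[symmetric] bumps by simp
  next
    case True
    then have e: "exp (\<theta> k) < 1" if "k \<in> {1..m}" for k using that by blast
    have sub: "k \<in> {1..m}" if "k \<in> I" for k using that unfolding I(3) by simp
    have mm: "m \<in> {1..m}" using m by simp
    have phase: "phase m \<sigma> \<tau> z r = - (\<Sum>k\<in>I. (\<sigma> k - \<sigma> m) * \<theta> k + \<tau> k * L k) - \<tau> m * L m"
    proof -
      have "(\<Sum>k\<in>I. 2 * (\<sigma> k - \<sigma> m) * ln (r k) + \<tau> k * ln (max (1 - (r k)\<^sup>2) 0)) =
          (\<Sum>k\<in>I. (\<sigma> k - \<sigma> m) * \<theta> k + \<tau> k * L k)"
      proof (intro sum.cong refl)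
        fix k assume k: "k \<in> I"
        have "max (1 - exp (\<theta> k)) 0 = 1 - exp (\<theta> k)" using e[OF sub[OF k]] by simp
        then show "2 * (\<sigma> k - \<sigma> m) * ln (r k) + \<tau> k * ln (max (1 - (r k)\<^sup>2) 0) =
            (\<sigma> k - \<sigma> m) * \<theta> k + \<tau> k * L k"
          unfolding r(3)[OF k] unfolding r(1)[OF k] by (simp add: L_def)
      qed
      moreover have "max (1 - exp (\<theta> m)) 0 = 1 - exp (\<theta> m)" using e[OF mm] by simp
      ultimately show ?thesis
        unfolding phase_def I_def[symmetric] last L_def by simp
    qed
    have amp: "amplitude m b r * (\<Prod>k\<in>I. h * exp (ln (\<rho> k) / 2 + h * w k)) =
        exp (\<Sum>k\<in>I. (b k - b m) * \<theta> k) * h ^ (m - 1)"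
    proof -
      have "amplitude m b r * (\<Prod>k\<in>I. h * exp (ln (\<rho> k) / 2 + h * w k)) =
          (\<Prod>k\<in>I. r k powr (2 * (b k - b m) - 1) * (h * r k))"
        unfolding amplitude_def I_def[symmetric] prod.distrib[symmetric]
        by (intro prod.cong refl) (simp add: r_def I_def)
      also have "\<dots> = (\<Prod>k\<in>I. exp ((b k - b m) * \<theta> k) * h)"
      proof (intro prod.cong refl)
        fix k assume k: "k \<in> I"
        show "r k powr (2 * (b k - b m) - 1) * (h * r k) = exp ((b k - b m) * \<theta> k) * h"
        proof -
          have e: "(2 * (b k - b m) - 1) * (\<theta> k / 2) + \<theta> k / 2 = (b k - b m) * \<theta> k"
            by (simp add: field_simps)
          have "exp (\<theta> k / 2) powr (2 * (b k - b m) - 1) * (h * exp (\<theta> k / 2)) =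
              exp ((2 * (b k - b m) - 1) * (\<theta> k / 2) + \<theta> k / 2) * h"
            by (simp add: powr_def exp_add)
          then show ?thesis unfolding r(1)[OF k] e .
        qed
      qed
      also have "\<dots> = exp (\<Sum>k\<in>I. (b k - b m) * \<theta> k) * h ^ (m - 1)"
        using I(1) by (simp add: prod.distrib exp_sum I_def)
      finally show ?thesis .
    qed
    have "weight_integrand m \<sigma> \<tau> b N z r * (\<Prod>k\<in>I. h * exp (ln (\<rho> k) / 2 + h * w k)) =
        exp (- real N * phase m \<sigma> \<tau> z r) * (amplitude m b r * (\<Prod>k\<in>I. h * exp (ln (\<rho> k) / 2 + h * w k)))"
      unfolding weight_integrand_def I_def[symmetric] using cond True by simp
    also have "\<dots> = exp ((\<Sum>k\<in>I. (A k - A m) * \<theta> k + real N * \<tau> k * L k) + real N * \<tau> m * L m) * h ^ (m - 1)"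
      unfolding amp phase
      by (simp add: exp_add[symmetric] sum_distrib_left sum.distrib[symmetric] A_def algebra_simps
          del: sum.distrib)
    \<comment> \<open>At k = m the coefficient A m - A m vanishes, so this index may join the sum.
      The common part A m then becomes a power of x, because the \<theta> k sum to ln x.\<close>
    also have "(\<Sum>k\<in>I. (A k - A m) * \<theta> k + real N * \<tau> k * L k) + real N * \<tau> m * L m =
        (\<Sum>k\<in>{1..m}. (A k - A m) * \<theta> k + real N * \<tau> k * L k)"
      using I(1,2) unfolding I(3) by simp
    also have "\<dots> = - A m * ln x + (\<Sum>k\<in>{1..m}. A k * \<theta> k + real N * \<tau> k * L k)"
      unfolding \<theta>_sum[symmetric] by (simp add: sum.distrib[symmetric] sum_distrib_left sum_negf[symmetric] algebra_simps)
    \<comment> \<open>The tilt: the added terms sum to 0, since the \<theta> k and the ln (\<rho> k)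
      both have total ln x, and they replace \<sigma> k by \<sigma> k + t in each profile.\<close>
    also have "(\<Sum>k\<in>{1..m}. A k * \<theta> k + real N * \<tau> k * L k) =
        (\<Sum>k\<in>{1..m}. A k * \<theta> k + real N * \<tau> k * L k + t * real N * (\<theta> k - ln (\<rho> k)))"
      using \<theta>_sum ln_x by (simp add: sum.distrib sum_distrib_left[symmetric] sum_subtractf)
    also have "exp (- A m * ln x + \<dots>) = x powr (- A m) *
        (\<Prod>k\<in>{1..m}. exp (A k * \<theta> k + real N * \<tau> k * L k + t * real N * (\<theta> k - ln (\<rho> k))))"
      using x by (simp add: powr_def exp_add[symmetric] exp_sum[symmetric])
    also have "(\<Prod>k\<in>{1..m}. exp (A k * \<theta> k + real N * \<tau> k * L k + t * real N * (\<theta> k - ln (\<rho> k)))) =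
        (\<Prod>k\<in>{1..m}. (\<rho> k powr A k * (1 - \<rho> k) powr (\<tau> k * real N)) * ?b k)"
    proof (intro prod.cong refl)
      fix k assume k: "k \<in> {1..m}"
      have q: "(\<sigma> k + t + \<tau> k - (\<sigma> k + t) * exp (u k / sqrt (real N))) / \<tau> k = (1 - exp (\<theta> k)) / (1 - \<rho> k)"
      proof -
        have "exp (\<theta> k) = (\<sigma> k + t) * exp (u k / sqrt (real N)) / (\<sigma> k + t + \<tau> k)"
          using \<rho>[OF k] by (simp add: \<theta>_def exp_add) (simp add: \<rho>_def)
        then have "1 - exp (\<theta> k) = (\<sigma> k + t + \<tau> k - (\<sigma> k + t) * exp (u k / sqrt (real N))) / (\<sigma> k + t + \<tau> k)"
          using \<tau>[OF k] t[OF k] by (simp add: diff_divide_distrib)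
        moreover have "1 - \<rho> k = \<tau> k / (\<sigma> k + t + \<tau> k)"
          using \<tau>[OF k] t[OF k] by (simp add: \<rho>_def field_simps)
        ultimately show ?thesis using \<tau>[OF k] t[OF k] by simp
      qed
      have ln_q: "ln ((1 - exp (\<theta> k)) / (1 - \<rho> k)) = L k - ln (1 - \<rho> k)"
        using e[OF k] \<rho>[OF k] by (simp add: L_def ln_div)
      have "?b k = exp (((\<sigma> k + t) * (sqrt (real N))\<^sup>2 + (b k + 1)) * u k / sqrt (real N)) *
          ((1 - exp (\<theta> k)) / (1 - \<rho> k)) powr (\<tau> k * (sqrt (real N))\<^sup>2)"
        unfolding bump_def q using bump_cond[OF k] e[OF k] by simp
      also have "\<dots> = exp ((A k + t * real N) * (\<theta> k - ln (\<rho> k)) + \<tau> k * real N * (L k - ln (1 - \<rho> k)))"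
      proof -
        have "((\<sigma> k + t) * (sqrt (real N))\<^sup>2 + (b k + 1)) * u k / sqrt (real N) =
            (A k + t * real N) * (\<theta> k - ln (\<rho> k))"
          by (simp add: A_def \<theta>_def algebra_simps add_divide_distrib)
        moreover have "((1 - exp (\<theta> k)) / (1 - \<rho> k)) powr (\<tau> k * (sqrt (real N))\<^sup>2) =
            exp (\<tau> k * real N * (L k - ln (1 - \<rho> k)))"
          unfolding ln_q[symmetric] using e[OF k] \<rho>[OF k] by (simp add: powr_def)
        ultimately show ?thesis by (simp only: exp_add)
      qed
      finally have bk: "?b k = exp ((A k + t * real N) * (\<theta> k - ln (\<rho> k)) + \<tau> k * real N * (L k - ln (1 - \<rho> k)))" .
      have "\<rho> k powr A k * (1 - \<rho> k) powr (\<tau> k * real N) = exp (A k * ln (\<rho> k) + \<tau> k * real N * ln (1 - \<rho> k))"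
        using \<rho>[OF k] by (simp add: powr_def exp_add)
      then show "exp (A k * \<theta> k + real N * \<tau> k * L k + t * real N * (\<theta> k - ln (\<rho> k))) =
          (\<rho> k powr A k * (1 - \<rho> k) powr (\<tau> k * real N)) * ?b k"
        unfolding bk by (simp add: exp_add[symmetric] algebra_simps)
    qed
    finally show ?thesis
      unfolding x_def[symmetric] I_def[symmetric] bumps prod.distrib by (simp add: mult_ac)
  qed
qed

text \<open>The integrand vanishes outside the open unit cube, so its integral is one over the
  positive orthant, to which the exponential substitution applies. The factor 2^(m-1) of the weight
  cancels the halves in the Jacobians.\<close>

lemma weight_eq_bump_conv:
  fixes \<sigma> \<tau> b :: "nat \<Rightarrow> real"
  assumes m: "m \<ge> 1" and N: "N > 0" and z: "z \<noteq> 0"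
    and \<tau>: "\<And>k. k \<in> {1..m} \<Longrightarrow> \<tau> k > 0" and t: "\<And>k. k \<in> {1..m} \<Longrightarrow> \<sigma> k + t > 0"
    and prod: "(\<Prod>k\<in>{1..m}. (\<sigma> k + t) / (\<sigma> k + t + \<tau> k)) = (cmod z)\<^sup>2"
  defines "\<rho> \<equiv> \<lambda>k. (\<sigma> k + t) / (\<sigma> k + t + \<tau> k)" and "A \<equiv> \<lambda>k. \<sigma> k * real N + b k + 1"
  shows "weight m \<sigma> \<tau> b N z = 1 / (pi * (cmod z)\<^sup>2) * (1 / sqrt (real N)) ^ (m - 1) *
    (\<Prod>k\<in>{1..m}. \<rho> k powr A k * (1 - \<rho> k) powr (\<tau> k * real N)) *
    (\<Prod>k\<in>{1..m}. Gamma (A k + \<tau> k * real N + 1) / (Gamma (A k) * Gamma (\<tau> k * real N + 1))) *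
    bump_conv (\<lambda>k. \<sigma> k + t) \<tau> (\<lambda>k. b k + 1) {1..<m} m (sqrt (real N))"
proof -
  define I where "I = {1..<m}"
  have I: "finite I" by (simp add: I_def)
  let ?M = "PiM I (\<lambda>_. lborel :: real measure)"
  define h where "h = 1 / (2 * sqrt (real N))"
  have h: "h > 0" using N by (simp add: h_def)
  define f where "f = weight_integrand m \<sigma> \<tau> b N z"
  define c where "c k = ln (\<rho> k) / 2" for k
  define E where "E = ((cmod z)\<^sup>2) powr (- A m) *
    (\<Prod>k\<in>{1..m}. \<rho> k powr A k * (1 - \<rho> k) powr (\<tau> k * real N)) * h ^ (m - 1)"
  define G where "G w = (\<Prod>k\<in>I. bump (\<sigma> k + t) (\<tau> k) (b k + 1) (sqrt (real N)) (w k)) *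
    bump (\<sigma> m + t) (\<tau> m) (b m + 1) (sqrt (real N)) (- (\<Sum>k\<in>I. w k))" for w
  have f_meas [measurable]: "f \<in> borel_measurable ?M"
  proof -
    have [measurable]: "(\<lambda>r. r k) \<in> borel_measurable ?M" if "k \<in> I" for k
      using measurable_component_singleton[OF that, of "\<lambda>_. lborel :: real measure"] by simp
    have [measurable]: "Measurable.pred ?M (\<lambda>r. \<forall>k\<in>I. 0 < r k \<and> 0 < 1 - (r k)\<^sup>2)"
      by (intro pred_intros_finite(3) I) measurable
    show ?thesis
      unfolding f_def weight_integrand_def phase_def amplitude_def I_def[symmetric]
      by measurable
  qed
  have f_nonneg: "f r \<ge> 0" for r
    by (simp add: f_def weight_integrand_def amplitude_def prod_nonneg)
  have f_pos: "0 < r k \<and> r k < 1" if "f r \<noteq> 0" "k \<in> I" for r k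
  proof -
    have "r k > 0" "1 - (r k)\<^sup>2 > 0"
      using that by (auto simp: f_def weight_integrand_def I_def split: if_splits)
    then show ?thesis by (simp add: power_less_one_iff)
  qed
  have subst: "f (\<lambda>k\<in>I. exp (c k + h * w k)) * (\<Prod>k\<in>I. h * exp (c k + h * w k)) = E * G w" for w
    unfolding f_def c_def I_def E_def G_def h_def \<rho>_def A_def
    by (rule weight_integrand_substitution) (use assms in auto)
  have G_nonneg: "G w \<ge> 0" for w by (simp add: G_def prod_nonneg bump_nonneg)
  have [measurable]: "G \<in> borel_measurable ?M"
    unfolding G_def by measurable
  have E_nonneg: "E \<ge> 0" using h by (simp add: E_def prod_nonneg)
  have "(LINT r : (\<Pi>\<^sub>E k\<in>{1..<m}. {0..1}) | (\<Pi>\<^sub>M k\<in>{1..<m}. lborel). weight_integrand m \<sigma> \<tau> b N z r) =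
      (\<integral>r. f r \<partial>?M)"
    unfolding set_lebesgue_integral_def I_def[symmetric] f_def[symmetric]
  proof (intro Bochner_Integration.integral_cong refl)
    fix r assume "r \<in> space ?M"
    then have "r \<in> extensional I" by (simp add: space_PiM PiE_def)
    \<comment> \<open>Points of the product space are extensional, as membership in the cube
      requires.\<close>
    then have "r \<in> (\<Pi>\<^sub>E k\<in>I. {0..1})" if "f r \<noteq> 0"
      using f_pos[OF that] by (intro PiE_I) (auto simp: extensional_def intro: less_imp_le)
    then show "indicator (\<Pi>\<^sub>E k\<in>I. {0..1}) r *\<^sub>R f r = f r"
      by (cases "f r = 0") auto
  qed
  \<comment> \<open>Both passages between Bochner and nonnegative integrals also cover divergence,
    where the Bochner integral and \<open>enn2real\<close> of infinity are 0.\<close>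
  also have "\<dots> = enn2real (\<integral>\<^sup>+r. ennreal (f r) \<partial>?M)"
    by (rule integral_eq_nn_integral) (auto simp: f_nonneg)
  also have "(\<integral>\<^sup>+r. ennreal (f r) \<partial>?M) = (\<integral>\<^sup>+r. ennreal (f r) * indicator {r. \<forall>k\<in>I. 0 < r k} r \<partial>?M)"
  proof (rule nn_integral_cong)
    fix r
    show "ennreal (f r) = ennreal (f r) * indicator {r. \<forall>k\<in>I. 0 < r k} r"
      using f_pos[of r] by (cases "f r = 0") auto
  qed
  also have "\<dots> = (\<integral>\<^sup>+w. ennreal (f (\<lambda>k\<in>I. exp (c k + h * w k))) *
      (\<Prod>k\<in>I. ennreal (h * exp (c k + h * w k))) \<partial>?M)"
    by (rule nn_integral_PiM_exp_substitution[OF I, where h = "\<lambda>_. h"]) (use h in auto)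
  also have "\<dots> = (\<integral>\<^sup>+w. ennreal (E * G w) \<partial>?M)"
  proof (rule nn_integral_cong)
    fix w
    have "(\<Prod>k\<in>I. ennreal (h * exp (c k + h * w k))) = ennreal (\<Prod>k\<in>I. h * exp (c k + h * w k))"
      using h by (intro prod_ennreal) simp
    then show "ennreal (f (\<lambda>k\<in>I. exp (c k + h * w k))) * (\<Prod>k\<in>I. ennreal (h * exp (c k + h * w k))) =
        ennreal (E * G w)"
      unfolding subst[symmetric] by (simp only: ennreal_mult'[OF f_nonneg])
  qed
  also have "enn2real \<dots> = (\<integral>w. E * G w \<partial>?M)"
    by (rule integral_eq_nn_integral[symmetric])
      (auto simp: G_nonneg E_nonneg)
  also have "\<dots> = E * bump_conv (\<lambda>k. \<sigma> k + t) \<tau> (\<lambda>k. b k + 1) {1..<m} m (sqrt (real N))"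
    by (simp add: bump_conv_def G_def I_def)
  finally have int: "(LINT r : (\<Pi>\<^sub>E k\<in>{1..<m}. {0..1}) | (\<Pi>\<^sub>M k\<in>{1..<m}. lborel). weight_integrand m \<sigma> \<tau> b N z r) =
    E * bump_conv (\<lambda>k. \<sigma> k + t) \<tau> (\<lambda>k. b k + 1) {1..<m} m (sqrt (real N))" .
  have gam: "(\<Prod>k\<in>{1..m}. Gamma ((\<sigma> k + \<tau> k) * real N + b k + 2)
        / (Gamma (\<sigma> k * real N + b k + 1) * Gamma (\<tau> k * real N + 1))) =
      (\<Prod>k\<in>{1..m}. Gamma (A k + \<tau> k * real N + 1) / (Gamma (A k) * Gamma (\<tau> k * real N + 1)))"
    by (intro prod.cong refl) (simp add: A_def algebra_simps)
  have "cmod z powr (2 * \<sigma> m * real N + 2 * b m) = ((cmod z)\<^sup>2) powr (A m - 1)"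
    using z by (simp add: A_def powr_def ln_realpow algebra_simps)
  then have "2 ^ (m - 1) * cmod z powr (2 * \<sigma> m * real N + 2 * b m) * E =
      (2 * h) ^ (m - 1) * (((cmod z)\<^sup>2) powr (A m - 1) * ((cmod z)\<^sup>2) powr (- A m)) *
      (\<Prod>k\<in>{1..m}. \<rho> k powr A k * (1 - \<rho> k) powr (\<tau> k * real N))"
    by (simp add: E_def power_mult_distrib)
  \<comment> \<open>The prefactor |z|^(2 \<sigma> m N + 2 b m) of the weight cancels the power from
    the constraint up to 1 / |z|^2, the one in the limiting density.\<close>
  also have "((cmod z)\<^sup>2) powr (A m - 1) * ((cmod z)\<^sup>2) powr (- A m) = 1 / (cmod z)\<^sup>2"
    using z by (simp only: powr_add[symmetric]) (simp add: powr_minus_divide)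
  also have "2 * h = 1 / sqrt (real N)" by (simp add: h_def)
  finally have pre: "2 ^ (m - 1) * cmod z powr (2 * \<sigma> m * real N + 2 * b m) * E =
      (1 / sqrt (real N)) ^ (m - 1) * (1 / (cmod z)\<^sup>2) *
      (\<Prod>k\<in>{1..m}. \<rho> k powr A k * (1 - \<rho> k) powr (\<tau> k * real N))" .
  have split: "p * q / pi * g * (E * J) = 1 / pi * (p * q * E) * g * J" for p q g J :: real
    by simp
  show ?thesis
    unfolding weight_def int gam split pre by (simp add: mult_ac)
qed

text \<open>An exact identity at fixed N. The ratios of Gamma functions in front of weight and sum
  cancel up to 1 / Gamma (\<tau> k N + 1), which completes the l-th coefficient to a reciprocal Beta
  function; |z|^(2 l) is spread over the factors as the product of the
  \<open>\<rho> k ^ l\<close>.\<close>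

lemma correlation_eq_bump_conv:
  fixes \<sigma> \<tau> b :: "nat \<Rightarrow> real"
  assumes m: "m \<ge> 1" and N: "N > 0" and z: "z \<noteq> 0"
    and \<tau>: "\<And>k. k \<in> {1..m} \<Longrightarrow> \<tau> k > 0" and t: "\<And>k. k \<in> {1..m} \<Longrightarrow> \<sigma> k + t > 0"
    and prod: "(\<Prod>k\<in>{1..m}. (\<sigma> k + t) / (\<sigma> k + t + \<tau> k)) = (cmod z)\<^sup>2"
    and A: "\<And>k. k \<in> {1..m} \<Longrightarrow> \<sigma> k * real N + b k > -1"
  shows "1 / of_nat N * correlation m \<sigma> \<tau> b N [z] = complex_of_real (1 / (pi * (cmod z)\<^sup>2) *
    (bump_conv (\<lambda>k. \<sigma> k + t) \<tau> (\<lambda>k. b k + 1) {1..<m} m (sqrt (real N)) *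
      (\<Sum>l<N. \<Prod>k\<in>{1..m}. 1 / bump_mgf (\<sigma> k + t) (\<tau> k) (b k + 1) (sqrt (real N)) ((real l - t * real N) / sqrt (real N)))
      / sqrt (real N)))"
proof -
  define \<rho> where "\<rho> k = (\<sigma> k + t) / (\<sigma> k + t + \<tau> k)" for k
  define a where "a k = \<sigma> k * real N + b k + 1" for k
  define B where "B k = a k + \<tau> k * real N + 1" for k
  define D where "D k = \<rho> k powr a k * (1 - \<rho> k) powr (\<tau> k * real N)" for k
  define x where "x = (cmod z)\<^sup>2"
  define n where "n = sqrt (real N)"
  define J where "J = bump_conv (\<lambda>k. \<sigma> k + t) \<tau> (\<lambda>k. b k + 1) {1..<m} m n"
  define P where "P k l = bump_mgf (\<sigma> k + t) (\<tau> k) (b k + 1) n ((real l - t * real N) / n)" for k l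
  have n: "n > 0" "n\<^sup>2 = real N" using N by (auto simp: n_def)
  have x: "x > 0" using z by (simp add: x_def)
  have \<rho>: "0 < \<rho> k" "\<rho> k < 1" if "k \<in> {1..m}" for k
    using \<tau>[OF that] t[OF that] by (auto simp: \<rho>_def)
  have \<rho>_prod: "(\<Prod>k\<in>{1..m}. \<rho> k) = x" using prod by (simp add: \<rho>_def x_def)
  have a: "a k > 0" if "k \<in> {1..m}" for k using A[OF that] by (simp add: a_def)
  have \<tau>N: "\<tau> k * real N > 0" if "k \<in> {1..m}" for k using \<tau>[OF that] N by simp
  have B: "B k > 0" if "k \<in> {1..m}" for k using a[OF that] \<tau>N[OF that] by (simp add: B_def)
  have J: "J \<ge> 0"
    unfolding J_def bump_conv_def
    by (intro integral_nonneg_AE AE_I2 mult_nonneg_nonneg prod_nonneg) (auto simp: bump_nonneg)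
  have W: "weight m \<sigma> \<tau> b N z = 1 / (pi * x) * (1 / n) ^ (m - 1) * (\<Prod>k\<in>{1..m}. D k) *
      (\<Prod>k\<in>{1..m}. Gamma (B k) / (Gamma (a k) * Gamma (\<tau> k * real N + 1))) * J"
    unfolding D_def B_def \<rho>_def a_def x_def n_def J_def
    by (rule weight_eq_bump_conv[OF m N z \<tau> t prod])
  \<comment> \<open>Nonnegativity, together with the dependence on |z| alone, reduces the square
    root in the kernel to the weight itself.\<close>
  have "weight m \<sigma> \<tau> b N z \<ge> 0"
    unfolding W D_def using x n J \<rho> a B \<tau>N
    by (intro mult_nonneg_nonneg prod_nonneg ballI divide_nonneg_nonneg zero_le_power)
      (auto intro!: Gamma_real_nonneg less_imp_le add_pos_pos)
  moreover have "weight m \<sigma> \<tau> b N (cnj z) = weight m \<sigma> \<tau> b N z"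
  proof -
    have "phase m \<sigma> \<tau> (cnj z) = phase m \<sigma> \<tau> z"
      by (simp add: phase_def fun_eq_iff)
    then have "weight_integrand m \<sigma> \<tau> b N (cnj z) = weight_integrand m \<sigma> \<tau> b N z"
      by (intro ext) (simp add: weight_integrand_def)
    then show ?thesis by (simp only: weight_def complex_mod_cnj)
  qed
  ultimately have "kernel m \<sigma> \<tau> b N z z = of_real (weight m \<sigma> \<tau> b N z) * truncated_sum m \<sigma> \<tau> b N z z"
    by (simp add: kernel_def)
  moreover have "correlation m \<sigma> \<tau> b N [z] = kernel m \<sigma> \<tau> b N z z"
    unfolding correlation_def by (subst Determinant.det_single) auto
  moreover have "truncated_sum m \<sigma> \<tau> b N z z = of_real ((\<Prod>k\<in>{1..m}. Gamma (a k) / Gamma (B k)) *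
      (\<Sum>l<N. (\<Prod>k\<in>{1..m}. Gamma (B k + real l) / Gamma (a k + real l)) * x ^ l))"
  proof -
    have "z * cnj z = of_real x" by (simp add: x_def complex_norm_square[symmetric])
    moreover have "(\<Prod>k\<in>{1..m}. Gamma (\<sigma> k * real N + b k + 1) / Gamma ((\<sigma> k + \<tau> k) * real N + b k + 2)) =
        (\<Prod>k\<in>{1..m}. Gamma (a k) / Gamma (B k))"
      by (intro prod.cong refl) (simp add: a_def B_def algebra_simps)
    moreover have "(\<Prod>k\<in>{1..m}. Gamma ((\<sigma> k + \<tau> k) * real N + b k + real l + 2) / Gamma (\<sigma> k * real N + b k + real l + 1)) =
        (\<Prod>k\<in>{1..m}. Gamma (B k + real l) / Gamma (a k + real l))" for l
      by (intro prod.cong refl) (simp add: a_def B_def algebra_simps)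
    ultimately show ?thesis by (simp add: truncated_sum_def)
  qed
  ultimately have corr: "1 / of_nat N * correlation m \<sigma> \<tau> b N [z] = complex_of_real (1 / real N * (weight m \<sigma> \<tau> b N z *
      ((\<Prod>k\<in>{1..m}. Gamma (a k) / Gamma (B k)) *
      (\<Sum>l<N. (\<Prod>k\<in>{1..m}. Gamma (B k + real l) / Gamma (a k + real l)) * x ^ l))))"
    by simp
  have P: "1 / P k l = D k * \<rho> k ^ l * Gamma (B k + real l) / (n * Gamma (a k + real l) * Gamma (\<tau> k * real N + 1))"
    if k: "k \<in> {1..m}" for k l
  proof -
    \<comment> \<open>The tilt t in the parameter of the profile is undone by the argument of the
      generating function.\<close>
    have eq: "(\<sigma> k + t) * n\<^sup>2 + (b k + 1) + (real l - t * real N) / n * n = a k + real l"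
    proof -
      have "(real l - t * real N) / n * n = real l - t * real N" using n by simp
      then show ?thesis unfolding n(2) a_def by (simp add: algebra_simps)
    qed
    have "P k l = n * Beta (a k + real l) (\<tau> k * n\<^sup>2 + 1) /
        (\<rho> k powr (a k + real l) * (1 - \<rho> k) powr (\<tau> k * n\<^sup>2))"
      unfolding P_def \<rho>_def
      by (rule bump_mgf_eq_Beta[OF t[OF k] \<tau>[OF k] n(1) eq]) (use a[OF k] in simp)
    also have "\<rho> k powr (a k + real l) * (1 - \<rho> k) powr (\<tau> k * n\<^sup>2) = D k * \<rho> k ^ l"
      using \<rho>[OF k] by (simp add: D_def powr_add powr_realpow n)
    also have "Beta (a k + real l) (\<tau> k * n\<^sup>2 + 1) = Gamma (a k + real l) * Gamma (\<tau> k * real N + 1) / Gamma (B k + real l)"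
      by (simp add: Beta_def B_def n add_ac)
    finally show ?thesis by (simp add: mult_ac)
  qed
  have W_sum: "(\<Prod>k\<in>{1..m}. D k) * (\<Prod>k\<in>{1..m}. Gamma (B k) / (Gamma (a k) * Gamma (\<tau> k * real N + 1))) *
      (\<Prod>k\<in>{1..m}. Gamma (a k) / Gamma (B k)) * ((\<Prod>k\<in>{1..m}. Gamma (B k + real l) / Gamma (a k + real l)) * x ^ l) =
      n ^ m * (\<Prod>k\<in>{1..m}. 1 / P k l)" for l
  proof -
    have "n ^ m * (\<Prod>k\<in>{1..m}. 1 / P k l) = (\<Prod>k\<in>{1..m}. n * (1 / P k l))"
      by (simp only: prod.distrib prod_constant card_atLeastAtMost) simp
    also have "\<dots> = (\<Prod>k\<in>{1..m}. D k * (Gamma (B k) / (Gamma (a k) * Gamma (\<tau> k * real N + 1))) *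
        (Gamma (a k) / Gamma (B k)) * ((Gamma (B k + real l) / Gamma (a k + real l)) * \<rho> k ^ l))"
    proof (intro prod.cong refl)
      fix k assume k: "k \<in> {1..m}"
      have "Gamma (B k) > 0" "Gamma (a k) > 0"
        using a[OF k] B[OF k] by (auto intro: Gamma_real_pos)
      then show "n * (1 / P k l) = D k * (Gamma (B k) / (Gamma (a k) * Gamma (\<tau> k * real N + 1))) *
        (Gamma (a k) / Gamma (B k)) * ((Gamma (B k + real l) / Gamma (a k + real l)) * \<rho> k ^ l)"
        unfolding P[OF k] using n by (simp add: mult_ac)
    qed
    also have "\<dots> = (\<Prod>k\<in>{1..m}. D k) * (\<Prod>k\<in>{1..m}. Gamma (B k) / (Gamma (a k) * Gamma (\<tau> k * real N + 1))) *
      (\<Prod>k\<in>{1..m}. Gamma (a k) / Gamma (B k)) * ((\<Prod>k\<in>{1..m}. Gamma (B k + real l) / Gamma (a k + real l)) * x ^ l)"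
      unfolding \<rho>_prod[symmetric] by (simp only: prod.distrib prod_power_distrib)
    finally show ?thesis by simp
  qed
  have "weight m \<sigma> \<tau> b N z * ((\<Prod>k\<in>{1..m}. Gamma (a k) / Gamma (B k)) *
      (\<Sum>l<N. (\<Prod>k\<in>{1..m}. Gamma (B k + real l) / Gamma (a k + real l)) * x ^ l)) =
    1 / (pi * x) * (1 / n) ^ (m - 1) * J *
      (\<Sum>l<N. (\<Prod>k\<in>{1..m}. D k) * (\<Prod>k\<in>{1..m}. Gamma (B k) / (Gamma (a k) * Gamma (\<tau> k * real N + 1))) *
      (\<Prod>k\<in>{1..m}. Gamma (a k) / Gamma (B k)) * ((\<Prod>k\<in>{1..m}. Gamma (B k + real l) / Gamma (a k + real l)) * x ^ l))"
    unfolding W sum_distrib_left[symmetric] by (simp only: mult_ac)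
  also have "\<dots> = 1 / (pi * x) * (1 / n) ^ (m - 1) * J * (n ^ m * (\<Sum>l<N. \<Prod>k\<in>{1..m}. 1 / P k l))"
    unfolding W_sum sum_distrib_left[symmetric] ..
  \<comment> \<open>Power count: m generating functions against m - 1 Jacobians leave n = N / n; the
    N is removed by the normalisation of the density and 1 / n is the mesh.\<close>
  also have "\<dots> = real N * (1 / (pi * x) * (J * (\<Sum>l<N. \<Prod>k\<in>{1..m}. 1 / P k l) / n))"
  proof -
    obtain j where "m = Suc j" using m by (cases m) auto
    then have "(1 / n) ^ (m - 1) * n ^ m = n"
      using n(1) by (simp add: power_one_over)
    also have "n = real N / n" using n by (simp add: field_simps power2_eq_square)
    finally have "(1 / n) ^ (m - 1) * n ^ m = real N / n" .
    moreover have "1 / (pi * x) * p * J * (q * S) = 1 / (pi * x) * J * S * (p * q)"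
      "real N * (1 / (pi * x) * (J * S / n)) = 1 / (pi * x) * J * S * (real N / n)" for p q S :: real
      by simp_all
    ultimately show ?thesis by (simp only:)
  qed
  finally show ?thesis
    unfolding corr using N by (simp add: P_def J_def n_def x_def)
qed

section \<open>The limiting density at a point of the punctured unit disc\<close>

theorem theorem5p6:
  fixes m :: nat and \<sigma> \<tau> b :: "nat \<Rightarrow> real" and z :: complex
  assumes "m \<ge> 1"
    and "\<forall>\<^sub>F N in sequentially. \<forall>k\<in>{1..m}. \<sigma> k * real N + b k > -1"
    and "\<forall>k\<in>{1..m}. \<sigma> k \<ge> 0"
    and "\<forall>k\<in>{1..m}. \<tau> k > 0"
    and "0 < cmod z" and "cmod z < 1"
  shows "(\<lambda>N. 1 / of_nat N * correlation m \<sigma> \<tau> b N [z]) \<longlonglongrightarrow>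
    complex_of_real
      (1 / (pi * (cmod z)\<^sup>2)
       * (1 / (\<Sum>k\<in>{1..m}. 1 / (\<sigma> k - \<sigma> m + (cmod z)\<^sup>2 * zeta m \<sigma> \<tau> z)
                - 1 / (\<sigma> k - \<sigma> m + \<tau> k + (cmod z)\<^sup>2 * zeta m \<sigma> \<tau> z)))
       * annulus_chi (r_in m \<sigma> \<tau>) (r_out m \<sigma> \<tau>) z)"
proof -
  have \<sigma>: "\<sigma> k \<ge> 0" and \<tau>: "\<tau> k > 0" if "k \<in> {1..m}" for k
    using assms(3,4) that by auto
  have z: "z \<noteq> 0" and x: "0 < (cmod z)\<^sup>2" "(cmod z)\<^sup>2 < 1"
    using assms(5,6) by (auto simp: power_less_one_iff)
  obtain t where t: "\<And>k. k \<in> {1..m} \<Longrightarrow> \<sigma> k + t > 0"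
    and prod: "(\<Prod>k\<in>{1..m}. (\<sigma> k + t) / (\<sigma> k + t + \<tau> k)) = (cmod z)\<^sup>2"
    using saddle_point_exists[of m \<tau> "(cmod z)\<^sup>2" \<sigma>] assms(1) \<tau> x by blast
  have zeta: "(cmod z)\<^sup>2 * zeta m \<sigma> \<tau> z = \<sigma> m + t"
    by (rule zeta_eq_saddle_point[OF assms(1) \<tau> z t prod])
  have chi: "annulus_chi (r_in m \<sigma> \<tau>) (r_out m \<sigma> \<tau>) z = step_chi t"
    by (rule annulus_chi_eq_step_chi[OF assms(1) \<sigma> \<tau> t prod])
  have ins: "{1..m} = insert m {1..<m}" using assms(1) by auto
  have V: "(\<Sum>k\<in>{1..m}. 1 / (\<sigma> k - \<sigma> m + (cmod z)\<^sup>2 * zeta m \<sigma> \<tau> z)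
      - 1 / (\<sigma> k - \<sigma> m + \<tau> k + (cmod z)\<^sup>2 * zeta m \<sigma> \<tau> z)) = (\<Sum>k\<in>{1..m}. bump_var (\<sigma> k + t) (\<tau> k))"
    unfolding zeta bump_var_def by (intro sum.cong refl) (simp add: add_ac)
  \<comment> \<open>The tilt drops out, and what remains is \<sigma> k N + b k + 1 > 0, the
    assumption on the parameters.\<close>
  have ev: "\<forall>\<^sub>F N in sequentially. \<forall>k\<in>{1..m}. (\<sigma> k + t - t) * real N + (b k + 1) > 0"
    using assms(2)
  proof eventually_elim
    case (elim N)
    then show ?case by force
  qed
  have lim: "(\<lambda>N. bump_conv (\<lambda>k. \<sigma> k + t) \<tau> (\<lambda>k. b k + 1) {1..<m} m (sqrt (real N)) *
      (\<Sum>l<N. \<Prod>k\<in>{1..m}. 1 / bump_mgf (\<sigma> k + t) (\<tau> k) (b k + 1) (sqrt (real N)) ((real l - t * real N) / sqrt (real N)))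
      / sqrt (real N)) \<longlonglongrightarrow> step_chi t / (\<Sum>k\<in>{1..m}. bump_var (\<sigma> k + t) (\<tau> k))"
    using t \<tau> ev unfolding ins by (intro bump_conv_sum_tendsto) auto
  have "(\<lambda>N. complex_of_real (1 / (pi * (cmod z)\<^sup>2) *
      (bump_conv (\<lambda>k. \<sigma> k + t) \<tau> (\<lambda>k. b k + 1) {1..<m} m (sqrt (real N)) *
      (\<Sum>l<N. \<Prod>k\<in>{1..m}. 1 / bump_mgf (\<sigma> k + t) (\<tau> k) (b k + 1) (sqrt (real N)) ((real l - t * real N) / sqrt (real N)))
      / sqrt (real N)))) \<longlonglongrightarrow>
    complex_of_real (1 / (pi * (cmod z)\<^sup>2) * (step_chi t / (\<Sum>k\<in>{1..m}. bump_var (\<sigma> k + t) (\<tau> k))))"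
    by (intro tendsto_of_real tendsto_mult tendsto_const lim)
  moreover have "\<forall>\<^sub>F N in sequentially. complex_of_real (1 / (pi * (cmod z)\<^sup>2) *
      (bump_conv (\<lambda>k. \<sigma> k + t) \<tau> (\<lambda>k. b k + 1) {1..<m} m (sqrt (real N)) *
      (\<Sum>l<N. \<Prod>k\<in>{1..m}. 1 / bump_mgf (\<sigma> k + t) (\<tau> k) (b k + 1) (sqrt (real N)) ((real l - t * real N) / sqrt (real N)))
      / sqrt (real N))) = 1 / of_nat N * correlation m \<sigma> \<tau> b N [z]"
    using assms(2) eventually_gt_at_top[of 0]
    by eventually_elim (rule correlation_eq_bump_conv[OF assms(1) _ z \<tau> t prod, symmetric]; simp)
  ultimately have "(\<lambda>N. 1 / of_nat N * correlation m \<sigma> \<tau> b N [z]) \<longlonglongrightarrow>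
      complex_of_real (1 / (pi * (cmod z)\<^sup>2) * (step_chi t / (\<Sum>k\<in>{1..m}. bump_var (\<sigma> k + t) (\<tau> k))))"
    by (rule Lim_transform_eventually)
  then show ?thesis unfolding V chi by simp
qed

end
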